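(* Let $n\ge1$. For all $k\in\{0,1,\dots,n\}$, all $f:\{-1,1\}^n\to[-1,1]$, all $p\in[1,2]$ and $q\in[1,2)$, $$\sum_{J\subseteq[n]:|J|=k}\frac{\|D_Jf\|_{L^p}^{p}}{\Big[1+\frac{q}{2k(2-q)}\ln^{+}\big(\|D_Jf\|_{L^p}^{p}/\|D_Jf\|_{L^q}^{2}\big)\Big]^{k}}\ \ge\ C(q)^k\,W^{\ge k}(f),\qquad C(q)=\Big(1+\frac{q}{2e(2-q)}\Big)^{-1}.$$ Moreover there is an absolute constant $c>0$ with $C(q)\ge c\,(2-q)$ for all $q\in[1,2)$.
   Context: The cube $\{-1,1\}^n$ carries the uniform probability measure; $L^p$ norms and the $L^2$ inner product are with respect to it. For $f:\{-1,1\}^n\to\mathbb R$ and $i\in[n]=\{1,\dots,n\}$, $D_i f(x)=\frac{1}{2}\big(f(x^{(i\mapsto 1)})-f(x^{(i\mapsto -1)})\big)$, where $x^{(i\mapsto\pm1)}$ is $x$ with its $i$-th coordinate replaced by $\pm1$. For $J\subseteq[n]$, $D_J:=\prod_{i\in J}D_i$, with $D_\varnothing$ the identity. For $0\le k\le n$, $\nabla^k f:=(D_Jf)_{|J|=k}$; $f^{\ge k}$ is the component of $f$ orthogonal in $L^2$ to the null space of $\nabla^k$, and $W^{\ge k}(f):=\|f^{\ge k}\|_{L^2}^2$; equivalently $W^{\ge k}(f)=\sum_{|S|\ge k}\widehat f(S)^2$ with $\widehat f(S)=\mathbb E[f\chi_S]$, $\chi_S(x)=\prod_{i\in S}x_i$.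 $\ln^+(x)=\max\{\ln x,0\}$. Conventions: summands with $D_Jf=0$ are $0$; for $k=0$ the bracket raised to the power $k=0$ equals $1$. *)

theory Defs
  imports "HOL-Analysis.Analysis" "HOL-Library.FuncSet"
begin

section \<open>The discrete cube\<close>

text \<open>
  Points of the cube are extensional functions on \<open>{1..n}\<close>. A real function on the cube is any
  \<open>f :: (nat \<Rightarrow> real) \<Rightarrow> real\<close>; only its values on \<open>cube n\<close> matter.
\<close>

definition cube :: "nat \<Rightarrow> (nat \<Rightarrow> real) set" where
  "cube n = {1..n} \<rightarrow>\<^sub>E {-1, 1}"

definition cube_measure :: "nat \<Rightarrow> (nat \<Rightarrow> real) measure" where
  "cube_measure n = uniform_count_measure (cube n)"

definition cube_norm :: "nat \<Rightarrow> real \<Rightarrow> ((nat \<Rightarrow> real) \<Rightarrow> real) \<Rightarrow> real" where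
  "cube_norm n p f = (\<integral>x. \<bar>f x\<bar> powr p \<partial>cube_measure n) powr (1 / p)"

definition cube_inner :: "nat \<Rightarrow> ((nat \<Rightarrow> real) \<Rightarrow> real) \<Rightarrow> ((nat \<Rightarrow> real) \<Rightarrow> real) \<Rightarrow> real" where
  "cube_inner n f g = (\<integral>x. f x * g x \<partial>cube_measure n)"


section \<open>Discrete derivatives\<close>

definition disc_deriv :: "nat \<Rightarrow> ((nat \<Rightarrow> real) \<Rightarrow> real) \<Rightarrow> (nat \<Rightarrow> real) \<Rightarrow> real" where
  "disc_deriv i f = (\<lambda>x. (f (x(i := 1)) - f (x(i := -1))) / 2)"

text \<open>The \<open>disc_deriv i\<close> commute, so the product over \<open>J\<close> may be taken in any order.\<close>

lemma comp_fun_commute_disc_deriv: "comp_fun_commute disc_deriv"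
proof
  fix i j :: nat
  show "disc_deriv j \<circ> disc_deriv i = disc_deriv i \<circ> disc_deriv j"
    by (cases "i = j") (simp_all add: fun_eq_iff disc_deriv_def fun_upd_twist[of i j] field_simps)
qed

definition disc_deriv_set :: "nat set \<Rightarrow> ((nat \<Rightarrow> real) \<Rightarrow> real) \<Rightarrow> (nat \<Rightarrow> real) \<Rightarrow> real" where
  "disc_deriv_set J f = Finite_Set.fold disc_deriv f J"

definition grad_null :: "nat \<Rightarrow> nat \<Rightarrow> ((nat \<Rightarrow> real) \<Rightarrow> real) set" where
  "grad_null n k =
     {g. \<forall>J. J \<subseteq> {1..n} \<and> card J = k \<longrightarrow> (\<forall>x\<in>cube n. disc_deriv_set J g x = 0)}"


section \<open>The part of degree at least \<open>k\<close> and its weight\<close>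

text \<open>
  \<open>is_high_part n k f h\<close>: \<open>h\<close> is the component of \<open>f\<close> orthogonal to the null space of the
  \<open>k\<close>-th gradient. It is taken extensional on the cube, so that it is unique as a function on all
  of \<open>nat \<Rightarrow> real\<close> (see \<open>ex1_high_part\<close> below).
\<close>

definition is_high_part ::
  "nat \<Rightarrow> nat \<Rightarrow> ((nat \<Rightarrow> real) \<Rightarrow> real) \<Rightarrow> ((nat \<Rightarrow> real) \<Rightarrow> real) \<Rightarrow> bool" where
  "is_high_part n k f h \<longleftrightarrow>
     h \<in> extensional (cube n) \<and>
     (\<forall>g\<in>grad_null n k. cube_inner n h g = 0) \<and>
     (\<lambda>x. f x - h x) \<in> grad_null n k"

definition high_part :: "nat \<Rightarrow> nat \<Rightarrow> ((nat \<Rightarrow> real) \<Rightarrow> real) \<Rightarrow> (nat \<Rightarrow> real) \<Rightarrow> real" where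
  "high_part n k f = (THE h. is_high_part n k f h)"

definition high_weight :: "nat \<Rightarrow> nat \<Rightarrow> ((nat \<Rightarrow> real) \<Rightarrow> real) \<Rightarrow> real" where
  "high_weight n k f = (cube_norm n 2 (high_part n k f))\<^sup>2"

text \<open>
  Since \<open>0 powr p = 0\<close>, \<open>0 / 0 = 0\<close> and \<open>ln 0 = 0\<close>, a quotient
  with numerator \<open>cube_norm n p g powr p\<close> vanishes for \<open>g = 0\<close>, whatever \<open>ln_plus\<close>
  contributes to the denominator.
\<close>

definition ln_plus :: "real \<Rightarrow> real" where
  "ln_plus x = max (ln x) 0"

definition Cconst :: "real \<Rightarrow> real" where
  "Cconst q = inverse (1 + q / (2 * exp 1 * (2 - q)))"


section \<open>Well-definedness of the high part, and the Fourier formula for its weight\<close>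

definition chi :: "nat set \<Rightarrow> (nat \<Rightarrow> real) \<Rightarrow> real" where
  "chi S x = (\<Prod>i\<in>S. x i)"

definition fourier :: "nat \<Rightarrow> ((nat \<Rightarrow> real) \<Rightarrow> real) \<Rightarrow> nat set \<Rightarrow> real" where
  "fourier n f S = cube_inner n f (chi S)"

lemma finite_cube: "finite (cube n)"
  unfolding cube_def by (intro finite_PiE) auto

lemma card_cube: "card (cube n) = 2 ^ n"
  unfolding cube_def by (simp add: card_PiE numeral_2_eq_2)

lemma cube_integral:
  fixes f :: "(nat \<Rightarrow> real) \<Rightarrow> real"
  shows "(\<integral>x. f x \<partial>cube_measure n) = (\<Sum>x\<in>cube n. f x) / 2 ^ n"
  unfolding cube_measure_def by (simp add: integral_uniform_count_measure finite_cube card_cube)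

lemma cube_upd: "x \<in> cube n \<Longrightarrow> i \<in> {1..n} \<Longrightarrow> a \<in> {-1, 1} \<Longrightarrow> x(i := a) \<in> cube n"
  unfolding cube_def PiE_iff extensional_def by auto

lemma cube_inner_cong:
  "(\<And>x. x \<in> cube n \<Longrightarrow> f x = f' x) \<Longrightarrow> (\<And>x. x \<in> cube n \<Longrightarrow> g x = g' x) \<Longrightarrow>
   cube_inner n f g = cube_inner n f' g'"
  unfolding cube_inner_def cube_integral by (simp cong: sum.cong)

lemma cube_inner_diff_left:
  "cube_inner n (\<lambda>x. f x - g x) h = cube_inner n f h - cube_inner n g h"
  unfolding cube_inner_def cube_integral
  by (simp add: algebra_simps sum_subtractf diff_divide_distrib)

lemma cube_inner_commute: "cube_inner n f g = cube_inner n g f"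
  unfolding cube_inner_def by (simp add: mult.commute)

lemma cube_inner_sum_left:
  "cube_inner n (\<lambda>x. \<Sum>S\<in>A. c S * g S x) h = (\<Sum>S\<in>A. c S * cube_inner n (g S) h)"
  unfolding cube_inner_def cube_integral
  by (simp add: sum_distrib_right sum_distrib_left sum_divide_distrib mult_ac)
    (rule sum.swap)

lemma cube_inner_eq_0D:
  assumes "cube_inner n f f = 0" "x \<in> cube n"
  shows "f x = 0"
proof -
  have "(\<Sum>x\<in>cube n. f x * f x) = 0"
    using assms(1) unfolding cube_inner_def cube_integral by simp
  then show ?thesis
    using assms(2) by (subst (asm) sum_nonneg_eq_0_iff) (auto simp: finite_cube)
qed

lemma cube_norm_2: "(cube_norm n 2 f)\<^sup>2 = cube_inner n f f"
  unfolding cube_norm_def cube_inner_def cube_integral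
  by (simp add: powr_half_sqrt power2_eq_square sum_nonneg)

lemma disc_deriv_set_empty [simp]: "disc_deriv_set {} f = f"
  by (simp add: disc_deriv_set_def)

lemma disc_deriv_set_insert:
  "finite J \<Longrightarrow> i \<notin> J \<Longrightarrow> disc_deriv_set (insert i J) f = disc_deriv i (disc_deriv_set J f)"
  unfolding disc_deriv_set_def
  using comp_fun_commute_on.fold_insert[OF comp_fun_commute_disc_deriv[unfolded comp_fun_commute_def']]
  by simp

lemma disc_deriv_set_cong:
  assumes "J \<subseteq> {1..n}" "\<And>x. x \<in> cube n \<Longrightarrow> f x = g x" "x \<in> cube n"
  shows "disc_deriv_set J f x = disc_deriv_set J g x"
proof -
  have "finite J" using assms(1) finite_subset by blast
  then show ?thesis using assms(1,3)
  proof (induction J arbitrary: x rule: finite_induct)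
    case empty
    then show ?case using assms(2) by simp
  next
    case (insert i J)
    then show ?case
      by (simp add: disc_deriv_set_insert disc_deriv_def cube_upd)
  qed
qed

lemma disc_deriv_set_sum:
  assumes "finite J"
  shows "disc_deriv_set J (\<lambda>x. \<Sum>S\<in>A. c S * g S x) = (\<lambda>x. \<Sum>S\<in>A. c S * disc_deriv_set J (g S) x)"
  using assms
proof (induction J rule: finite_induct)
  case (insert i J)
  then show ?case
    by (simp add: disc_deriv_set_insert disc_deriv_def fun_eq_iff sum_subtractf[symmetric]
        sum_divide_distrib right_diff_distrib diff_divide_distrib)
qed simp

lemma disc_deriv_set_diff:
  assumes "finite J"
  shows "disc_deriv_set J (\<lambda>x. f x - g x) = (\<lambda>x. disc_deriv_set J f x - disc_deriv_set J g x)"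
  using assms
proof (induction J rule: finite_induct)
  case (insert i J)
  then show ?case
    by (simp add: disc_deriv_set_insert disc_deriv_def fun_eq_iff diff_divide_distrib)
qed simp

lemma disc_deriv_zero [simp]: "disc_deriv i (\<lambda>x. 0) = (\<lambda>x. 0)"
  by (simp add: disc_deriv_def)

lemma disc_deriv_chi:
  assumes "finite S"
  shows "disc_deriv i (chi S) = (if i \<in> S then chi (S - {i}) else (\<lambda>x. 0))"
proof (cases "i \<in> S")
  case True
  have "chi S (x(i := a)) = a * chi (S - {i}) x" for x a
    unfolding chi_def by (subst prod.remove[OF assms True]) (auto intro!: prod.cong)
  then show ?thesis using True by (simp add: disc_deriv_def)
next
  case False
  have "chi S (x(i := a)) = chi S x" for x a
    unfolding chi_def using False by (auto intro!: prod.cong)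
  then show ?thesis using False by (simp add: disc_deriv_def)
qed

lemma disc_deriv_set_chi:
  assumes "finite J" "finite S"
  shows "disc_deriv_set J (chi S) = (if J \<subseteq> S then chi (S - J) else (\<lambda>x. 0))"
  using assms(1)
proof (induction J rule: finite_induct)
  case (insert i J)
  have "S - J - {i} = S - insert i J" by auto
  then show ?case using insert assms(2)
    by (auto simp: disc_deriv_set_insert disc_deriv_chi)
qed simp

lemma chi_orthonormal:
  assumes "S \<subseteq> {1..n}" "T \<subseteq> {1..n}"
  shows "cube_inner n (chi S) (chi T) = (if S = T then 1 else 0)"
proof -
  define \<phi> where "\<phi> i a = (if i \<in> S then a else 1) * (if i \<in> T then a else (1::real))" for i a
  have chi: "chi U x = (\<Prod>i\<in>{1..n}. if i \<in> U then x i else 1)" if "U \<subseteq> {1..n}" for U x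
    unfolding chi_def using that by (simp add: prod.If_cases Int_absorb1)
  have "(\<Sum>x\<in>cube n. chi S x * chi T x) = (\<Sum>x\<in>cube n. \<Prod>i\<in>{1..n}. \<phi> i (x i))"
    by (simp only: chi[OF assms(1)] chi[OF assms(2)] \<phi>_def prod.distrib)
  also have "\<dots> = (\<Prod>i\<in>{1..n}. \<Sum>a\<in>{-1, 1}. \<phi> i a)"
    unfolding cube_def by (rule prod_sum_PiE[symmetric]) auto
  also have "\<dots> = (\<Prod>i\<in>{1..n}. if i \<in> S \<longleftrightarrow> i \<in> T then 2 else 0)"
    by (intro prod.cong) (auto simp: \<phi>_def)
  also have "\<dots> = (if S = T then 2 ^ n else 0)"
    using assms by (auto simp: prod_zero_iff)
  finally show ?thesis
    unfolding cube_inner_def cube_integral by simp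
qed

lemma fourier_inversion:
  assumes "x \<in> cube n"
  shows "f x = (\<Sum>S\<in>Pow {1..n}. fourier n f S * chi S x)"
proof -
  have kernel: "(\<Sum>S\<in>Pow {1..n}. chi S y * chi S x) = (if y = x then 2 ^ n else 0)"
    if y: "y \<in> cube n" for y
  proof -
    have "(\<Sum>S\<in>Pow {1..n}. chi S y * chi S x) = (\<Prod>i\<in>{1..n}. y i * x i + 1)"
      by (subst prod_add) (auto simp: chi_def prod.distrib)
    also have "\<dots> = (\<Prod>i\<in>{1..n}. if y i = x i then 2 else 0)"
    proof (intro prod.cong refl)
      fix i assume "i \<in> {1..n}"
      then have "x i \<in> {-1, 1}" "y i \<in> {-1, 1}"
        using y assms unfolding cube_def by (blast dest: PiE_mem)+
      then show "y i * x i + 1 = (if y i = x i then 2 else 0)" by auto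
    qed
    also have "\<dots> = (if y = x then 2 ^ n else 0)"
    proof (cases "y = x")
      case False
      then obtain i where "i \<in> {1..n}" "y i \<noteq> x i"
        using y assms unfolding cube_def by (metis PiE_ext)
      then show ?thesis using False by (auto simp: prod_zero_iff)
    qed simp
    finally show ?thesis .
  qed
  have "(\<Sum>S\<in>Pow {1..n}. fourier n f S * chi S x)
      = (\<Sum>S\<in>Pow {1..n}. \<Sum>y\<in>cube n. f y * (chi S y * chi S x) / 2 ^ n)"
    unfolding fourier_def cube_inner_def cube_integral
    by (simp add: sum_distrib_left sum_distrib_right sum_divide_distrib mult_ac)
  also have "\<dots> = (\<Sum>y\<in>cube n. f y * (\<Sum>S\<in>Pow {1..n}. chi S y * chi S x) / 2 ^ n)"
    by (subst sum.swap) (simp add: sum_distrib_left sum_divide_distrib)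
  also have "\<dots> = (\<Sum>y\<in>cube n. if y = x then f y else 0)"
    by (intro sum.cong refl) (simp add: kernel del: One_nat_def)
  also have "\<dots> = f x"
    using assms by (simp add: finite_cube)
  finally show ?thesis by simp
qed

lemma grad_null_fourier:
  assumes g: "g \<in> grad_null n k" and S: "S \<subseteq> {1..n}" "k \<le> card S"
  shows "fourier n g S = 0"
proof -
  obtain J where J: "J \<subseteq> S" "card J = k"
    using S(2) by (meson obtain_subset_with_card_n)
  have fin: "finite U" if "U \<subseteq> {1..n}" for U :: "nat set"
    using that finite_subset by blast
  have Jn: "J \<subseteq> {1..n}" using J S by auto
  have "0 = cube_inner n (disc_deriv_set J g) (chi (S - J))"
    using g J Jn unfolding grad_null_def
    by (subst cube_inner_cong[where f' = "\<lambda>x. 0" and g' = "chi (S - J)"])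
      (auto simp: cube_inner_def)
  also have "\<dots> = cube_inner n (\<lambda>x. \<Sum>T\<in>Pow {1..n}. fourier n g T * disc_deriv_set J (chi T) x) (chi (S - J))"
  proof (rule cube_inner_cong[OF _ refl])
    fix x assume x: "x \<in> cube n"
    show "disc_deriv_set J g x = (\<Sum>T\<in>Pow {1..n}. fourier n g T * disc_deriv_set J (chi T) x)"
      by (subst disc_deriv_set_cong[OF Jn fourier_inversion[where f = g] x])
        (assumption, simp add: disc_deriv_set_sum fin[OF Jn])
  qed
  also have "\<dots> = (\<Sum>T\<in>Pow {1..n}. fourier n g T * cube_inner n (disc_deriv_set J (chi T)) (chi (S - J)))"
    by (rule cube_inner_sum_left)
  also have "\<dots> = (\<Sum>T\<in>Pow {1..n}. if T = S then fourier n g T else 0)"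
  proof (intro sum.cong refl)
    fix T assume "T \<in> Pow {1..n}"
    then have T: "T \<subseteq> {1..n}" by simp
    show "fourier n g T * cube_inner n (disc_deriv_set J (chi T)) (chi (S - J))
        = (if T = S then fourier n g T else 0)"
    proof (cases "J \<subseteq> T")
      case True
      have "cube_inner n (chi (T - J)) (chi (S - J)) = (if T - J = S - J then 1 else 0)"
        using T S by (intro chi_orthonormal) auto
      moreover have "T - J = S - J \<longleftrightarrow> T = S" using True J by auto
      ultimately show ?thesis using True by (simp add: disc_deriv_set_chi[OF fin[OF Jn] fin[OF T]])
    next
      case False
      then show ?thesis using J by (auto simp: disc_deriv_set_chi[OF fin[OF Jn] fin[OF T]] cube_inner_def)
    qed
  qed
  also have "\<dots> = fourier n g S" using S by simp
  finally show ?thesis by simp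
qed

lemma is_high_part_fourier:
  "is_high_part n k f
     (restrict (\<lambda>x. \<Sum>S | S \<subseteq> {1..n} \<and> k \<le> card S. fourier n f S * chi S x) (cube n))"
  (is "is_high_part n k f ?h")
proof -
  let ?A = "{S. S \<subseteq> {1..n} \<and> k \<le> card S}"
  have split: "Pow {1..n} = ?A \<union> {S. S \<subseteq> {1..n} \<and> card S < k}" by auto
  have "cube_inner n ?h g = 0" if "g \<in> grad_null n k" for g
  proof -
    have "cube_inner n ?h g = (\<Sum>S\<in>?A. fourier n f S * cube_inner n (chi S) g)"
      by (subst cube_inner_sum_left[symmetric]) (rule cube_inner_cong; simp)
    also have "\<dots> = 0"
      using grad_null_fourier[OF that]
      by (intro sum.neutral) (auto simp: fourier_def cube_inner_commute)
    finally show ?thesis .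
  qed
  moreover have "(\<lambda>x. f x - ?h x) \<in> grad_null n k"
    unfolding grad_null_def mem_Collect_eq
  proof (intro allI impI ballI, elim conjE)
    fix J x assume J: "J \<subseteq> {1..n}" "card J = k" and x: "x \<in> cube n"
    have fin: "finite J" using J(1) finite_subset by blast
    let ?B = "{S. S \<subseteq> {1..n} \<and> card S < k}"
    have "f y - ?h y = (\<Sum>S\<in>?B. fourier n f S * chi S y)" if "y \<in> cube n" for y
      using that by (subst fourier_inversion[of y n f], assumption, subst split)
        (subst sum.union_disjoint, auto)
    from disc_deriv_set_cong[OF J(1) this x]
    have "disc_deriv_set J (\<lambda>x. f x - ?h x) x
        = (\<Sum>S\<in>?B. fourier n f S * disc_deriv_set J (chi S) x)"
      by (simp add: disc_deriv_set_sum fin)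
    also have "\<dots> = 0"
    proof (intro sum.neutral ballI)
      fix S assume "S \<in> ?B"
      then have "finite S" "\<not> J \<subseteq> S"
        using J card_mono[of S J] finite_subset[of S "{1..n}"] by auto
      then show "fourier n f S * disc_deriv_set J (chi S) x = 0"
        by (simp add: disc_deriv_set_chi fin)
    qed
    finally show "disc_deriv_set J (\<lambda>x. f x - ?h x) x = 0" .
  qed
  ultimately show ?thesis unfolding is_high_part_def by auto
qed

lemma is_high_part_unique:
  assumes h: "is_high_part n k f h" and h': "is_high_part n k f h'"
  shows "h = h'"
proof -
  let ?d = "\<lambda>x. h x - h' x"
  have "?d \<in> grad_null n k"
  proof -
    have fin: "finite J" if "J \<subseteq> {1..n}" for J :: "nat set"
      using that finite_subset by blast
    have "disc_deriv_set J h x = disc_deriv_set J h' x"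
      if "J \<subseteq> {1..n}" "card J = k" "x \<in> cube n" for J x
      using h h' that unfolding is_high_part_def grad_null_def
      by (auto simp: disc_deriv_set_diff fin)
    then show ?thesis unfolding grad_null_def by (auto simp: disc_deriv_set_diff fin)
  qed
  then have "cube_inner n ?d ?d = 0"
    using h h' unfolding is_high_part_def by (subst cube_inner_diff_left) auto
  then have "h x = h' x" if "x \<in> cube n" for x
    using cube_inner_eq_0D[OF _ that, of ?d] by auto
  then show ?thesis
    using h h' unfolding is_high_part_def by (auto intro: extensionalityI)
qed

lemma ex1_high_part: "\<exists>!h. is_high_part n k f h"
  using is_high_part_fourier is_high_part_unique by blast

lemma high_weight_fourier:
  "high_weight n k f = (\<Sum>S | S \<subseteq> {1..n} \<and> k \<le> card S. (fourier n f S)\<^sup>2)"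
proof -
  let ?A = "{S. S \<subseteq> {1..n} \<and> k \<le> card S}"
  let ?h = "\<lambda>x. \<Sum>S\<in>?A. fourier n f S * chi S x"
  have "high_part n k f = restrict ?h (cube n)"
    unfolding high_part_def
    by (intro the_equality is_high_part_fourier is_high_part_unique[OF _ is_high_part_fourier])
  then have "high_weight n k f = cube_inner n ?h ?h"
    unfolding high_weight_def cube_norm_2 by (simp cong: cube_inner_cong)
  also have "\<dots> = (\<Sum>S\<in>?A. fourier n f S * cube_inner n ?h (chi S))"
    by (subst cube_inner_sum_left) (simp add: cube_inner_commute)
  also have "\<dots> = (\<Sum>S\<in>?A. (fourier n f S)\<^sup>2)"
  proof (intro sum.cong refl)
    fix S assume S: "S \<in> ?A"
    have "cube_inner n ?h (chi S) = (\<Sum>T\<in>?A. if T = S then fourier n f T else 0)"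
      unfolding cube_inner_sum_left using S by (intro sum.cong refl) (auto simp: chi_orthonormal)
    also have "\<dots> = fourier n f S" using S by simp
    finally show "fourier n f S * cube_inner n ?h (chi S) = (fourier n f S)\<^sup>2"
      by (simp add: power2_eq_square)
  qed
  finally show ?thesis .
qed

end

theory Submission
  imports Defs
begin

text \<open>
  Write \<open>g\<close> for a derivative \<open>disc_deriv_set J f\<close> with \<open>card J = k\<close>, and let \<open>P\<close> be the \<open>p\<close>-th power of its \<open>L\<^sup>p\<close> norm
  and \<open>N\<close> its squared \<open>L\<^sup>q\<close> norm. The weight of \<open>f\<close> at levels at least \<open>k\<close> is an average over noise levels:
  for \<open>k \<ge> 1\<close> it equals the sum over \<open>J\<close> of the integrals of \<open>k * u ^ (k - 1)\<close> times the squared \<open>L\<^sup>2\<close> norm of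
  \<open>g\<close> after noise with parameter \<open>sqrt (1 - u)\<close>, because the beta integral undoes the number of ways in
  which a frequency can be differentiated \<open>k\<close> times (\<open>high_weight_eq_integral\<close>). It therefore suffices to
  bound the integral for each \<open>J\<close> separately. For \<open>k = 0\<close> the claim is that the sum of all squared Fourier
  coefficients is at most \<open>P\<close>.

  Noise regularises: by hypercontractivity (\<open>cube_hypercontractivity\<close>), the norm after noise is at most
  the norm of \<open>g\<close> with exponent \<open>2 - u\<close>, and interpolation between \<open>L\<^sup>q\<close> and \<open>L\<^sup>2\<close> bounds the square of the
  latter by \<open>P * (N / P) powr \<theta>\<close> if \<open>N \<le> P\<close>, where \<open>\<theta> = min 1 (2 * a * u / (2 - u))\<close> and
  \<open>a = q / (2 * (2 - q))\<close>, the value \<open>\<theta> = 1\<close> standing for the range \<open>2 - u \<le> q\<close>. If \<open>P < N\<close>, the bound is \<open>P\<close>. Here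
  \<open>f\<close> being bounded by \<open>1\<close> is used to replace the squared \<open>L\<^sup>2\<close> norm by \<open>P\<close> (\<open>noise_energy_decay\<close>).

  It remains to integrate. Putting \<open>k * m = ln_plus (P / N)\<close>, the integrand is at most
  \<open>P * k * u ^ (k - 1) * F u ^ k\<close>
  with the decreasing function \<open>F u = exp (- m * \<theta>)\<close>, and for decreasing functions such an integral is at
  most the \<open>k\<close>-th power of the integral of \<open>F\<close> (\<open>power_weighted_integral_le\<close>). The integral of \<open>F\<close> is at most
  \<open>(1 + a / e) / (1 + a * m)\<close> (\<open>decay_integral_bound\<close>), in which \<open>1 / (1 + a / e)\<close> is the constant
  \<open>Cconst q\<close> and \<open>1 + a * m\<close> is the bracket of the theorem.
\<close>

section \<open>Hypercontractivity on the cube\<close>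

text \<open>
  The right-hand side, the even part of \<open>(1 + y) powr (1 + r)\<close>, dominates its Taylor polynomial of degree
  two at \<open>0\<close>, because its second derivative is \<open>r * (1 + r)\<close> times the mean of \<open>(1 + y) powr (r - 1)\<close> and \<open>(1 - y) powr (r - 1)\<close>; these
  two numbers have product at least \<open>1\<close>, hence mean at least \<open>1\<close>.
\<close>
lemma two_point_quadratic_lower_bound:
  fixes r y :: real
  assumes r: "0 \<le> r" "r \<le> 1" and y: "0 \<le> y" "y \<le> 1"
  shows "1 + (1 + r) * r * y\<^sup>2 / 2 \<le> ((1 + y) powr (1 + r) + (1 - y) powr (1 + r)) / 2"
proof -
  define \<psi> where "\<psi> t = (1 + t) powr r - (1 - t) powr r - 2 * r * t" for t
  define \<phi> where
    "\<phi> t = ((1 + t) powr (1 + r) + (1 - t) powr (1 + r)) / 2 - 1 - (1 + r) * r * t\<^sup>2 / 2" for t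
  have \<psi>_nonneg: "0 \<le> \<psi> t" if t: "0 \<le> t" "t < 1" for t
  proof -
    have "\<psi> 0 \<le> \<psi> t"
    proof (rule DERIV_nonneg_imp_nondecreasing[OF t(1)])
      fix x assume x: "0 \<le> x" "x \<le> t"
      let ?A = "(1 + x) powr (r - 1)" and ?B = "(1 - x) powr (r - 1)"
      have "(\<psi> has_real_derivative r * (?A + ?B - 2)) (at x)"
        unfolding \<psi>_def using x t
        by (auto intro!: derivative_eq_intros simp: algebra_simps)
      moreover have "2 \<le> ?A + ?B"
      proof -
        have "?A * ?B = ((1 + x) * (1 - x)) powr (r - 1)"
          using x t by (simp add: powr_mult)
        also have "\<dots> \<ge> 1"
        proof -
          have pos: "0 < (1 + x) * (1 - x)" using x t by simp
          have "(1 + x) * (1 - x) \<le> 1" by (simp add: algebra_simps)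
          then have "1 powr (r - 1) \<le> ((1 + x) * (1 - x)) powr (r - 1)"
            using r pos by (intro powr_mono2') auto
          then show ?thesis by simp
        qed
        finally have "1 \<le> ?A * ?B" .
        then have "2\<^sup>2 \<le> (?A + ?B)\<^sup>2"
          using zero_le_power2[of "?A - ?B"] by (simp add: power2_eq_square algebra_simps)
        then show ?thesis
          by (rule power2_le_imp_le) simp
      qed
      ultimately show "\<exists>d. (\<psi> has_real_derivative d) (at x) \<and> 0 \<le> d"
        using r by (intro exI[of _ "r * (?A + ?B - 2)"] conjI) auto
    qed
    then show ?thesis by (simp add: \<psi>_def)
  qed
  have "\<phi> 0 \<le> \<phi> y"
  proof (rule DERIV_nonneg_imp_increasing_open[OF y(1)])
    fix x assume x: "0 < x" "x < y"
    have "(\<phi> has_real_derivative (1 + r) / 2 * \<psi> x) (at x)"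
      unfolding \<phi>_def \<psi>_def using x y
      by (auto intro!: derivative_eq_intros simp: field_simps)
    then show "\<exists>d. (\<phi> has_real_derivative d) (at x) \<and> 0 \<le> d"
      using r \<psi>_nonneg[of x] x y by (intro exI[of _ "(1 + r) / 2 * \<psi> x"] conjI) auto
  next
    show "continuous_on {0..y} \<phi>"
      unfolding \<phi>_def using r y by (intro continuous_intros continuous_on_powr') auto
  qed
  then show ?thesis unfolding \<phi>_def by simp argo
qed

text \<open>
  Hypercontractivity on a cube of dimension one, for the function with values \<open>a\<close> and \<open>b\<close>. Both sides
  are homogeneous of degree two, so one may take \<open>a = 1 + y\<close> and \<open>b = 1 - y\<close>; then Bernoulli's inequality
  for the exponent \<open>(1 + r) / 2\<close> reduces the claim to the quadratic lower bound above.
\<close>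
lemma two_point_hypercontractivity:
  fixes r a b :: real
  assumes r: "0 \<le> r" "r \<le> 1" and ab: "0 \<le> a" "0 \<le> b"
  shows "((a + b) / 2)\<^sup>2 + r * ((a - b) / 2)\<^sup>2
    \<le> ((a powr (1 + r) + b powr (1 + r)) / 2) powr (2 / (1 + r))"
proof -
  have ordered: "((a + b) / 2)\<^sup>2 + r * ((a - b) / 2)\<^sup>2
    \<le> ((a powr (1 + r) + b powr (1 + r)) / 2) powr (2 / (1 + r))"
    if "0 < a" "0 \<le> b" "b \<le> a" for a b
  proof -
    define s y where "s = (a + b) / 2" and "y = (a - b) / (a + b)"
    have s: "0 < s" and y: "0 \<le> y" "y \<le> 1" using that by (auto simp: s_def y_def field_simps)
    have "s * 2 = a + b" by (simp add: s_def)
    moreover have "(a + b) * y = a - b" using that by (simp add: y_def)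
    ultimately have sy: "s * y = (a - b) / 2" by (metis mult.commute mult.assoc nonzero_mult_div_cancel_left zero_neq_numeral)
    have a: "a = s * (1 + y)" and b: "b = s * (1 - y)"
      using sy by (auto simp: algebra_simps s_def field_simps)
    define X where "X = ((1 + y) powr (1 + r) + (1 - y) powr (1 + r)) / 2"
    \<comment> \<open>Bernoulli's inequality, as weighted arithmetic and geometric mean with \<open>1\<close>.\<close>
    have bernoulli: "(1 + r * y\<^sup>2) powr ((1 + r) / 2) \<le> 1 + (1 + r) * r * y\<^sup>2 / 2"
    proof -
      have "0 < 1 + r * y\<^sup>2" using r by (simp add: add_pos_nonneg)
      then have "(1 + r * y\<^sup>2) powr ((1 + r) / 2) * 1 powr ((1 - r) / 2)
        \<le> (1 + r) / 2 * (1 + r * y\<^sup>2) + (1 - r) / 2 * 1"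
        using r by (intro Youngs_inequality_0) (auto simp: field_simps)
      then show ?thesis by (simp add: field_simps)
    qed
    also have "\<dots> \<le> X"
      unfolding X_def by (rule two_point_quadratic_lower_bound[OF r y])
    finally have "((1 + r * y\<^sup>2) powr ((1 + r) / 2)) powr (2 / (1 + r)) \<le> X powr (2 / (1 + r))"
      using r by (intro powr_mono2) auto
    moreover have "((1 + r * y\<^sup>2) powr ((1 + r) / 2)) powr (2 / (1 + r)) = 1 + r * y\<^sup>2"
    proof -
      have "(1 + r) / 2 * (2 / (1 + r)) = 1" using r by simp
      then show ?thesis using r by (simp only: powr_powr) (simp add: add_nonneg_nonneg)
    qed
    ultimately have X: "1 + r * y\<^sup>2 \<le> X powr (2 / (1 + r))" by simp
    have "((a + b) / 2)\<^sup>2 + r * ((a - b) / 2)\<^sup>2 = s\<^sup>2 * (1 + r * y\<^sup>2)"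
      unfolding sy[symmetric] s_def[symmetric] by (simp add: algebra_simps power2_eq_square)
    also have "\<dots> \<le> s\<^sup>2 * X powr (2 / (1 + r))"
      using X by (intro mult_left_mono) auto
    also have "s\<^sup>2 = (s powr (1 + r)) powr (2 / (1 + r))"
    proof -
      have "(1 + r) * (2 / (1 + r)) = 2" using r by (simp add: field_simps)
      then show ?thesis using s by (simp only: powr_powr) (simp add: powr_numeral)
    qed
    also have "\<dots> * X powr (2 / (1 + r)) = (s powr (1 + r) * X) powr (2 / (1 + r))"
      using s by (subst powr_mult) (auto simp: X_def)
    also have "s powr (1 + r) * X = (a powr (1 + r) + b powr (1 + r)) / 2"
      unfolding a b X_def powr_mult by (simp add: distrib_left)
    finally show ?thesis .
  qed
  consider "a = 0 \<and> b = 0" | "0 < a \<and> b \<le> a" | "0 < b \<and> a \<le> b" using ab by linarith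
  then show ?thesis
  proof cases
    case 3
    then show ?thesis using ordered[of b a] ab
      by (simp add: add.commute power2_commute[of a b] power_divide)
  qed (use ordered ab in auto)
qed

text \<open>
  This is the squared \<open>L\<^sup>2\<close> norm of \<open>T g\<close>, where the noise operator \<open>T\<close> has parameter \<open>sqrt r\<close>. At \<open>r = 0\<close>
  the convention \<open>0 ^ 0 = 1\<close> leaves the squared mean of \<open>g\<close>.
\<close>
definition noise_energy :: "nat \<Rightarrow> real \<Rightarrow> ((nat \<Rightarrow> real) \<Rightarrow> real) \<Rightarrow> real" where
  "noise_energy n r g = (\<Sum>S\<in>Pow {1..n}. r ^ card S * (fourier n g S)\<^sup>2)"

lemma cube_norm_nonneg: "0 \<le> cube_norm n p g"
  by (simp add: cube_norm_def)

lemma cube_norm_powr: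
  "0 < p \<Longrightarrow> cube_norm n p g powr p = (\<Sum>x\<in>cube n. \<bar>g x\<bar> powr p) / 2 ^ n"
  by (simp add: cube_norm_def cube_integral powr_powr sum_nonneg)

lemma sum_cube_Suc:
  "(\<Sum>x\<in>cube (Suc n). \<phi> x) = (\<Sum>y\<in>cube n. \<phi> (y(Suc n := 1)) + \<phi> (y(Suc n := -1)))"
proof -
  have eq: "cube (Suc n) = (\<lambda>(a, y). y(Suc n := a)) ` ({-1, 1} \<times> cube n)"
  proof -
    have "{1..Suc n} = insert (Suc n) {1..n}" by auto
    then show ?thesis by (simp only: cube_def PiE_insert_eq)
  qed
  have "inj_on (\<lambda>(a, y). y(Suc n := a)) ({-1, 1} \<times> cube n)"
    unfolding cube_def by (rule inj_combinator) auto
  then have "(\<Sum>x\<in>cube (Suc n). \<phi> x) = (\<Sum>(a, y)\<in>{-1, 1} \<times> cube n. \<phi> (y(Suc n := a)))"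
    unfolding eq by (subst sum.reindex) (auto intro!: sum.cong)
  also have "\<dots> = (\<Sum>a\<in>{-1, 1}. \<Sum>y\<in>cube n. \<phi> (y(Suc n := a)))"
    by (simp add: sum.cartesian_product)
  finally show ?thesis by (simp add: sum.distrib add.commute)
qed

lemma cube_norm_Suc_powr:
  assumes "0 < p"
  shows "cube_norm (Suc n) p g powr p =
    (cube_norm n p (\<lambda>x. g (x(Suc n := 1))) powr p +
     cube_norm n p (\<lambda>x. g (x(Suc n := -1))) powr p) / 2"
  using assms by (simp add: cube_norm_powr sum_cube_Suc sum.distrib add_divide_distrib mult.commute)

lemma chi_upd:
  assumes "S \<subseteq> {1..n}"
  shows "chi S (x(Suc n := a)) = chi S x" "chi (insert (Suc n) S) (x(Suc n := a)) = a * chi S x"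
proof -
  have S: "finite S" "Suc n \<notin> S" using assms finite_subset by auto
  then show 1: "chi S (x(Suc n := a)) = chi S x"
    unfolding chi_def by (intro prod.cong) auto
  show "chi (insert (Suc n) S) (x(Suc n := a)) = a * chi S x"
    using S 1 by (simp add: chi_def)
qed

lemma fourier_Suc:
  assumes "S \<subseteq> {1..n}"
  shows "fourier (Suc n) g S =
      (fourier n (\<lambda>x. g (x(Suc n := 1))) S + fourier n (\<lambda>x. g (x(Suc n := -1))) S) / 2"
    and "fourier (Suc n) g (insert (Suc n) S) =
      (fourier n (\<lambda>x. g (x(Suc n := 1))) S - fourier n (\<lambda>x. g (x(Suc n := -1))) S) / 2"
  by (simp_all add: fourier_def cube_inner_def cube_integral sum_cube_Suc chi_upd[OF assms]
      sum.distrib sum_subtractf add_divide_distrib diff_divide_distrib)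

text \<open>
  Splitting off the last coordinate: the two restrictions of \<open>g\<close> enter through their half sum, whose
  frequencies avoid the new coordinate, and their half difference, whose frequencies contain it and
  therefore carry one more factor \<open>r\<close>.
\<close>
lemma noise_energy_Suc:
  "noise_energy (Suc n) r g = (\<Sum>S\<in>Pow {1..n}. r ^ card S *
     (((fourier n (\<lambda>x. g (x(Suc n := 1))) S + fourier n (\<lambda>x. g (x(Suc n := -1))) S) / 2)\<^sup>2 +
      r * ((fourier n (\<lambda>x. g (x(Suc n := 1))) S - fourier n (\<lambda>x. g (x(Suc n := -1))) S) / 2)\<^sup>2))"
proof -
  have Pow: "Pow {1..Suc n} = Pow {1..n} \<union> insert (Suc n) ` Pow {1..n}"
    by (simp add: atLeastAtMostSuc_conv Pow_insert)
  have inj: "inj_on (insert (Suc n)) (Pow {1..n})"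
    by (rule inj_onI) (metis PowD atLeastAtMost_iff insert_ident not_less_eq_eq order_refl subsetD)
  have "noise_energy (Suc n) r g =
    (\<Sum>S\<in>Pow {1..n}. r ^ card S * (fourier (Suc n) g S)\<^sup>2) +
    (\<Sum>S\<in>Pow {1..n}. r ^ card (insert (Suc n) S) * (fourier (Suc n) g (insert (Suc n) S))\<^sup>2)"
  proof -
    have "finite (Pow {1..n})" "Pow {1..n} \<inter> insert (Suc n) ` Pow {1..n} = {}" by auto
    then show ?thesis
      unfolding noise_energy_def Pow
      by (simp only: sum.union_disjoint finite_imageI sum.reindex[OF inj] o_def)
  qed
  also have "\<dots> = (\<Sum>S\<in>Pow {1..n}. r ^ card S * ((fourier (Suc n) g S)\<^sup>2 +
      r * (fourier (Suc n) g (insert (Suc n) S))\<^sup>2))"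
    unfolding sum.distrib[symmetric]
  proof (intro sum.cong refl)
    fix S assume "S \<in> Pow {1..n}"
    then have "finite S" "Suc n \<notin> S" using finite_subset by auto
    then show "r ^ card S * (fourier (Suc n) g S)\<^sup>2 +
        r ^ card (insert (Suc n) S) * (fourier (Suc n) g (insert (Suc n) S))\<^sup>2
      = r ^ card S * ((fourier (Suc n) g S)\<^sup>2 + r * (fourier (Suc n) g (insert (Suc n) S))\<^sup>2)"
      by (simp add: algebra_simps)
  qed
  also have "\<dots> = (\<Sum>S\<in>Pow {1..n}. r ^ card S *
     (((fourier n (\<lambda>x. g (x(Suc n := 1))) S + fourier n (\<lambda>x. g (x(Suc n := -1))) S) / 2)\<^sup>2 +
      r * ((fourier n (\<lambda>x. g (x(Suc n := 1))) S - fourier n (\<lambda>x. g (x(Suc n := -1))) S) / 2)\<^sup>2))"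
    by (intro sum.cong refl) (simp add: fourier_Suc del: insert_iff)
  finally show ?thesis .
qed

lemma noise_energy_nonneg: "0 \<le> r \<Longrightarrow> 0 \<le> noise_energy n r g"
  unfolding noise_energy_def by (intro sum_nonneg) simp

text \<open>
  Cauchy-Schwarz for the bilinear form whose quadratic form is the noise energy.
\<close>
lemma fourier_product_sum_le:
  assumes "0 \<le> r"
  shows "(\<Sum>S\<in>Pow {1..n}. r ^ card S * (fourier n g S * fourier n h S))
    \<le> sqrt (noise_energy n r g) * sqrt (noise_energy n r h)"
proof -
  let ?w = "\<lambda>S::nat set. sqrt (r ^ card S)"
  have eq: "r ^ card S * (x * y) = (?w S * x) * (?w S * y)" for S :: "nat set" and x y
  proof -
    have "(?w S * x) * (?w S * y) = (?w S * ?w S) * (x * y)" by (simp only: mult_ac)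
    also have "?w S * ?w S = r ^ card S" using assms by simp
    finally show ?thesis ..
  qed
  have "(\<Sum>S\<in>Pow {1..n}. r ^ card S * (fourier n g S * fourier n h S))\<^sup>2
    = (\<Sum>S\<in>Pow {1..n}. (?w S * fourier n g S) * (?w S * fourier n h S))\<^sup>2"
    by (simp only: eq)
  also have "\<dots> \<le> noise_energy n r g * noise_energy n r h"
  proof -
    have "(?w S * fourier n g' S)\<^sup>2 = r ^ card S * (fourier n g' S)\<^sup>2" for S g'
      using assms by (simp add: power_mult_distrib)
    then show ?thesis
      unfolding noise_energy_def
      using Cauchy_Schwarz_ineq_sum[of "\<lambda>S. ?w S * fourier n g S" "\<lambda>S. ?w S * fourier n h S" "Pow {1..n}"]
      by simp
  qed
  finally show ?thesis
    by (simp add: real_le_rsqrt flip: real_sqrt_mult)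
qed

text \<open>
  The Bonami inequality, by induction on the dimension. By Cauchy-Schwarz, the noise energy in
  dimension \<open>n + 1\<close> is at most the two-point quadratic form at the square roots of the energies of the
  two restrictions. This form increases in both of its arguments, so the induction hypothesis allows
  replacing them by the \<open>L\<^sup>p\<close> norms of the restrictions, \<open>p = 1 + r\<close>, and the two-point inequality recombines
  these into the \<open>L\<^sup>p\<close> norm of \<open>g\<close>.
\<close>
lemma cube_hypercontractivity:
  assumes r: "0 \<le> r" "r \<le> 1"
  shows "noise_energy n r g \<le> (cube_norm n (1 + r) g)\<^sup>2"
proof (induction n arbitrary: g)
  case 0
  have "cube 0 = {\<lambda>_. undefined}" by (simp add: cube_def)
  then show ?case
    using r by (simp add: noise_energy_def fourier_def cube_inner_def cube_norm_def cube_integral chi_def powr_powr)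
next
  case (Suc n)
  let ?g = "\<lambda>x. g (x(Suc n := 1))" and ?h = "\<lambda>x. g (x(Suc n := -1))"
  define A B where "A = sqrt (noise_energy n r ?g)" and "B = sqrt (noise_energy n r ?h)"
  define \<alpha> \<beta> where "\<alpha> = cube_norm n (1 + r) ?g" and "\<beta> = cube_norm n (1 + r) ?h"
  have AB: "0 \<le> A" "A \<le> \<alpha>" "0 \<le> B" "B \<le> \<beta>"
    using Suc.IH[of ?g] Suc.IH[of ?h] noise_energy_nonneg[OF r(1)]
    by (auto simp: A_def B_def \<alpha>_def \<beta>_def cube_norm_nonneg intro: real_le_lsqrt)
  have sq: "A\<^sup>2 = noise_energy n r ?g" "B\<^sup>2 = noise_energy n r ?h"
    using noise_energy_nonneg[OF r(1)] by (simp_all add: A_def B_def)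
  \<comment> \<open>Written this way the quadratic form in two variables has nonnegative coefficients, so it is
    monotone on the positive quadrant.\<close>
  have form: "((x + y) / 2)\<^sup>2 + r * ((x - y) / 2)\<^sup>2 = (1 + r) / 4 * (x\<^sup>2 + y\<^sup>2) + (1 - r) / 2 * (x * y)"
    for x y by (simp add: power2_eq_square field_simps)
  have "noise_energy (Suc n) r g =
    (\<Sum>S\<in>Pow {1..n}. (1 + r) / 4 * (r ^ card S * (fourier n ?g S)\<^sup>2 + r ^ card S * (fourier n ?h S)\<^sup>2)
      + (1 - r) / 2 * (r ^ card S * (fourier n ?g S * fourier n ?h S)))"
    unfolding noise_energy_Suc form by (intro sum.cong refl) (simp add: algebra_simps)
  also have "\<dots> = (1 + r) / 4 * (A\<^sup>2 + B\<^sup>2) +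
      (1 - r) / 2 * (\<Sum>S\<in>Pow {1..n}. r ^ card S * (fourier n ?g S * fourier n ?h S))"
    unfolding sq noise_energy_def by (simp only: sum.distrib sum_distrib_left distrib_left)
  also have "\<dots> \<le> (1 + r) / 4 * (A\<^sup>2 + B\<^sup>2) + (1 - r) / 2 * (A * B)"
    using fourier_product_sum_le[OF r(1)] r
    by (intro add_left_mono mult_left_mono) (auto simp: A_def B_def)
  also have "\<dots> \<le> (1 + r) / 4 * (\<alpha>\<^sup>2 + \<beta>\<^sup>2) + (1 - r) / 2 * (\<alpha> * \<beta>)"
    using AB r by (intro add_mono mult_left_mono mult_mono power_mono) auto
  also have "\<dots> \<le> ((\<alpha> powr (1 + r) + \<beta> powr (1 + r)) / 2) powr (2 / (1 + r))"
    unfolding form[symmetric] using AB by (intro two_point_hypercontractivity[OF r]) auto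
  also have "\<dots> = (cube_norm (Suc n) (1 + r) g powr (1 + r)) powr (2 / (1 + r))"
    using r by (simp add: cube_norm_Suc_powr \<alpha>_def \<beta>_def)
  also have "\<dots> = cube_norm (Suc n) (1 + r) g powr 2"
  proof -
    have "(1 + r) * (2 / (1 + r)) = 2" using r by (simp add: field_simps)
    then show ?thesis by (simp only: powr_powr)
  qed
  also have "\<dots> = (cube_norm (Suc n) (1 + r) g)\<^sup>2"
    by (simp add: powr_numeral cube_norm_nonneg)
  finally show ?case .
qed

section \<open>Discrete derivatives and the high weight\<close>

lemma fourier_disc_deriv_set:
  assumes J: "J \<subseteq> {1..n}" and T: "T \<subseteq> {1..n}"
  shows "fourier n (disc_deriv_set J f) T = (if J \<inter> T = {} then fourier n f (J \<union> T) else 0)"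
proof -
  have fin: "finite U" if "U \<subseteq> {1..n}" for U :: "nat set"
    using that finite_subset by blast
  have "fourier n (disc_deriv_set J f) T
    = cube_inner n (\<lambda>x. \<Sum>S\<in>Pow {1..n}. fourier n f S * disc_deriv_set J (chi S) x) (chi T)"
    unfolding fourier_def[of n "disc_deriv_set J f"]
  proof (rule cube_inner_cong[OF _ refl])
    fix x assume x: "x \<in> cube n"
    show "disc_deriv_set J f x = (\<Sum>S\<in>Pow {1..n}. fourier n f S * disc_deriv_set J (chi S) x)"
      by (subst disc_deriv_set_cong[OF J fourier_inversion[where f = f] x])
        (assumption, simp add: disc_deriv_set_sum fin[OF J])
  qed
  also have "\<dots> = (\<Sum>S\<in>Pow {1..n}. fourier n f S * cube_inner n (disc_deriv_set J (chi S)) (chi T))"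
    by (rule cube_inner_sum_left)
  also have "\<dots> = (\<Sum>S\<in>Pow {1..n}. if S = J \<union> T then (if J \<inter> T = {} then fourier n f S else 0) else 0)"
  proof (intro sum.cong refl)
    fix S assume "S \<in> Pow {1..n}"
    then have S: "S \<subseteq> {1..n}" by simp
    have "cube_inner n (chi (S - J)) (chi T) = (if S - J = T then 1 else 0)"
      using S T by (intro chi_orthonormal) auto
    then have "cube_inner n (disc_deriv_set J (chi S)) (chi T) = (if J \<subseteq> S \<and> S - J = T then 1 else 0)"
      by (auto simp: disc_deriv_set_chi[OF fin[OF J] fin[OF S]] cube_inner_def)
    moreover have "J \<subseteq> S \<and> S - J = T \<longleftrightarrow> S = J \<union> T \<and> J \<inter> T = {}" by auto
    ultimately show "fourier n f S * cube_inner n (disc_deriv_set J (chi S)) (chi T)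
      = (if S = J \<union> T then (if J \<inter> T = {} then fourier n f S else 0) else 0)"
      by auto
  qed
  also have "\<dots> = (if J \<inter> T = {} then fourier n f (J \<union> T) else 0)"
    using J T by simp
  finally show ?thesis .
qed

text \<open>
  Differentiation along \<open>J\<close> keeps the frequencies that contain \<open>J\<close> and removes \<open>J\<close> from them.
\<close>
lemma noise_energy_disc_deriv_set:
  assumes J: "J \<subseteq> {1..n}"
  shows "noise_energy n r (disc_deriv_set J f)
    = (\<Sum>S | S \<subseteq> {1..n} \<and> J \<subseteq> S. r ^ (card S - card J) * (fourier n f S)\<^sup>2)"
proof -
  have "noise_energy n r (disc_deriv_set J f)
    = (\<Sum>T\<in>Pow {1..n}. if J \<inter> T = {} then r ^ card T * (fourier n f (J \<union> T))\<^sup>2 else 0)"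
    unfolding noise_energy_def by (intro sum.cong refl) (simp add: fourier_disc_deriv_set[OF J])
  also have "\<dots> = (\<Sum>T | T \<subseteq> {1..n} \<and> J \<inter> T = {}. r ^ card T * (fourier n f (J \<union> T))\<^sup>2)"
    by (subst sum.inter_filter[symmetric]) (auto intro!: sum.cong)
  also have "\<dots> = (\<Sum>S | S \<subseteq> {1..n} \<and> J \<subseteq> S. r ^ (card S - card J) * (fourier n f S)\<^sup>2)"
  proof (rule sum.reindex_bij_witness[of _ "\<lambda>S. S - J" "\<lambda>T. J \<union> T"])
    fix T assume T: "T \<in> {T. T \<subseteq> {1..n} \<and> J \<inter> T = {}}"
    then have "card (J \<union> T) = card J + card T"
      using J finite_subset[of _ "{1..n}"] by (intro card_Un_disjoint) auto
    then show "r ^ (card (J \<union> T) - card J) * (fourier n f (J \<union> T))\<^sup>2 = r ^ card T * (fourier n f (J \<union> T))\<^sup>2"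
      by simp
  qed (use J in auto)
  finally show ?thesis .
qed

lemma abs_disc_deriv_set_le:
  assumes "J \<subseteq> {1..n}" "\<And>x. x \<in> cube n \<Longrightarrow> \<bar>f x\<bar> \<le> b" "x \<in> cube n"
  shows "\<bar>disc_deriv_set J f x\<bar> \<le> b"
proof -
  have "finite J" using assms(1) finite_subset by blast
  then show ?thesis using assms(1,3)
  proof (induction J arbitrary: x rule: finite_induct)
    case empty
    then show ?case using assms(2) by simp
  next
    case (insert i J)
    have "\<bar>disc_deriv_set J f (x(i := 1))\<bar> \<le> b" "\<bar>disc_deriv_set J f (x(i := -1))\<bar> \<le> b"
      using insert by (auto intro!: insert.IH cube_upd)
    then show ?case
      using insert by (simp add: disc_deriv_set_insert disc_deriv_def)
  qed
qed

lemma beta_integral: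
  assumes "1 \<le> k" "k \<le> d"
  shows "((\<lambda>u::real. real k * u ^ (k - 1) * (1 - u) ^ (d - k)) has_integral 1 / real (d choose k)) {0..1}"
proof -
  have "((\<lambda>u. real k * (u powr (real k - 1) * (1 - u) powr (real (d - k + 1) - 1)))
      has_integral real k * Beta (real k) (real (d - k + 1))) {0..1}"
    using assms by (intro has_integral_mult_right has_integral_Beta_real) auto
  also have "real k * Beta (real k) (real (d - k + 1)) = 1 / real (d choose k)"
  proof -
    have "Gamma (real k) = fact (k - 1)"
      using Gamma_fact[of "k - 1", where 'a = real] assms by (simp add: of_nat_diff)
    moreover have "Gamma (real (d - k + 1)) = fact (d - k)"
      using Gamma_fact[of "d - k", where 'a = real] by (simp add: add.commute)
    moreover have "Gamma (real k + real (d - k + 1)) = fact d"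
      using Gamma_fact[of d, where 'a = real] assms by (simp add: of_nat_diff add.commute)
    ultimately have "Beta (real k) (real (d - k + 1)) = fact (k - 1) * fact (d - k) / fact d"
      by (simp add: Beta_def)
    moreover have "real k * fact (k - 1) = fact k"
      using assms by (simp add: fact_reduce)
    ultimately show ?thesis using assms by (simp add: binomial_fact)
  qed
  finally show ?thesis
  proof (rule has_integral_spike_finite[of "{0, 1}", rotated 2])
    fix u :: real assume "u \<in> {0..1} - {0, 1}"
    then show "real k * u ^ (k - 1) * (1 - u) ^ (d - k)
      = real k * (u powr (real k - 1) * (1 - u) powr (real (d - k + 1) - 1))"
      using assms powr_realpow[of u "k - 1"] powr_realpow[of "1 - u" "d - k"] by (simp add: of_nat_diff)
  qed simp
qed

text \<open>
  Each frequency \<open>S\<close> with \<open>k \<le> card S\<close> contains \<open>card S choose k\<close> of the sets \<open>J\<close>, and contributes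
  \<open>(1 - u) ^ (card S - k)\<close> times its squared coefficient to the energy for each of them. The weight in \<open>u\<close> is
  chosen such that the beta integral cancels the binomial coefficient.
\<close>
lemma high_weight_eq_integral:
  assumes k: "1 \<le> k"
  shows "high_weight n k f = (\<Sum>J | J \<subseteq> {1..n} \<and> card J = k.
    integral {0..1} (\<lambda>u. real k * u ^ (k - 1) * noise_energy n (1 - u) (disc_deriv_set J f)))"
proof -
  let ?\<J> = "{J. J \<subseteq> {1..n} \<and> card J = k}"
  let ?c = "\<lambda>S. (fourier n f S)\<^sup>2 / real (card S choose k)"
  have int: "integral {0..1} (\<lambda>u. real k * u ^ (k - 1) * noise_energy n (1 - u) (disc_deriv_set J f))
    = (\<Sum>S | S \<subseteq> {1..n} \<and> J \<subseteq> S. ?c S)" if J: "J \<subseteq> {1..n}" "card J = k" for J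
  proof (rule integral_unique)
    have "((\<lambda>u. \<Sum>S | S \<subseteq> {1..n} \<and> J \<subseteq> S.
        (fourier n f S)\<^sup>2 * (real k * u ^ (k - 1) * (1 - u) ^ (card S - k)))
      has_integral (\<Sum>S | S \<subseteq> {1..n} \<and> J \<subseteq> S. (fourier n f S)\<^sup>2 * (1 / real (card S choose k)))) {0..1}"
    proof (intro has_integral_sum has_integral_mult_right beta_integral k)
      fix S assume "S \<in> {S. S \<subseteq> {1..n} \<and> J \<subseteq> S}"
      then show "k \<le> card S" using J(2) finite_subset[of S "{1..n}"] card_mono[of S J] by auto
    qed simp
    then show "((\<lambda>u. real k * u ^ (k - 1) * noise_energy n (1 - u) (disc_deriv_set J f))
      has_integral (\<Sum>S | S \<subseteq> {1..n} \<and> J \<subseteq> S. ?c S)) {0..1}"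
      by (simp add: noise_energy_disc_deriv_set[OF J(1)] J(2) sum_distrib_left mult_ac)
  qed
  have "(\<Sum>J\<in>?\<J>. \<Sum>S | S \<subseteq> {1..n} \<and> J \<subseteq> S. ?c S) = (\<Sum>S\<in>Pow {1..n}. \<Sum>J | J \<in> ?\<J> \<and> J \<subseteq> S. ?c S)"
    using sum.swap_restrict[of ?\<J> "Pow {1..n}" "\<lambda>_ S. ?c S" "\<lambda>J S. J \<subseteq> S"] by simp
  also have "\<dots> = (\<Sum>S\<in>Pow {1..n}. if k \<le> card S then (fourier n f S)\<^sup>2 else 0)"
  proof (intro sum.cong refl)
    fix S assume S: "S \<in> Pow {1..n}"
    have "{J. J \<in> ?\<J> \<and> J \<subseteq> S} = {J. J \<subseteq> S \<and> card J = k}" using S by auto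
    moreover have "card \<dots> = card S choose k"
      using S finite_subset[of S "{1..n}"] by (intro n_subsets) auto
    ultimately show "(\<Sum>J | J \<in> ?\<J> \<and> J \<subseteq> S. ?c S) = (if k \<le> card S then (fourier n f S)\<^sup>2 else 0)"
      by simp
  qed
  also have "\<dots> = high_weight n k f"
    unfolding high_weight_fourier by (subst sum.inter_filter[symmetric]) (auto intro!: sum.cong)
  finally have "high_weight n k f = (\<Sum>J\<in>?\<J>. \<Sum>S | S \<subseteq> {1..n} \<and> J \<subseteq> S. ?c S)" ..
  also have "\<dots> = (\<Sum>J\<in>?\<J>. integral {0..1}
      (\<lambda>u. real k * u ^ (k - 1) * noise_energy n (1 - u) (disc_deriv_set J f)))"
    using int by (intro sum.cong refl) simp
  finally show ?thesis .
qed

section \<open>Decay of the energy under noise\<close>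

lemma cube_norm_sq: "0 < t \<Longrightarrow> (cube_norm n t g)\<^sup>2 = ((\<Sum>x\<in>cube n. \<bar>g x\<bar> powr t) / 2 ^ n) powr (2 / t)"
  by (simp add: cube_norm_def cube_integral powr_powr flip: powr_numeral)

lemma cube_norm_pos_iff:
  assumes "0 < t"
  shows "0 < cube_norm n t g \<longleftrightarrow> (\<exists>x\<in>cube n. g x \<noteq> 0)"
proof -
  have "0 < cube_norm n t g \<longleftrightarrow> (\<Sum>x\<in>cube n. \<bar>g x\<bar> powr t) \<noteq> 0"
    using sum_nonneg[of "cube n" "\<lambda>x. \<bar>g x\<bar> powr t"]
    by (auto simp: cube_norm_def cube_integral)
  then show ?thesis by (simp add: sum_nonneg_eq_0_iff finite_cube)
qed

text \<open>
  Hoelder's inequality for powers of one function, from the pointwise Young inequality applied after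
  both moments have been normalised to \<open>1\<close>.
\<close>
lemma moment_log_convex:
  fixes g :: "(nat \<Rightarrow> real) \<Rightarrow> real" and n :: nat and l s t :: real
  assumes "0 \<le> l" "l \<le> 1"
  defines "M \<equiv> \<lambda>t::real. (\<Sum>x\<in>cube n. \<bar>g x\<bar> powr t) / 2 ^ n"
  shows "M (l * s + (1 - l) * t) \<le> M s powr l * M t powr (1 - l)"
proof (cases "\<exists>x\<in>cube n. g x \<noteq> 0")
  case False
  then show ?thesis by (simp add: M_def)
next
  case True
  then obtain x0 where x0: "x0 \<in> cube n" "g x0 \<noteq> 0" by blast
  have pos: "0 < M t" for t
    unfolding M_def using x0 by (intro divide_pos_pos sum_pos2[of _ x0]) (auto simp: finite_cube)
  let ?r = "l * s + (1 - l) * t" and ?C = "M s powr l * M t powr (1 - l)"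
  have young: "\<bar>g x\<bar> powr ?r \<le> ?C * (l * (\<bar>g x\<bar> powr s / M s) + (1 - l) * (\<bar>g x\<bar> powr t / M t))" for x
  proof (cases "g x = 0")
    case False
    have "\<bar>g x\<bar> powr ?r = (\<bar>g x\<bar> powr s) powr l * (\<bar>g x\<bar> powr t) powr (1 - l)"
      by (simp add: powr_powr powr_add mult.commute)
    also have "\<dots> = ?C * ((\<bar>g x\<bar> powr s / M s) powr l * (\<bar>g x\<bar> powr t / M t) powr (1 - l))"
      using pos[of s] pos[of t] by (simp add: powr_divide)
    also have "\<dots> \<le> ?C * (l * (\<bar>g x\<bar> powr s / M s) + (1 - l) * (\<bar>g x\<bar> powr t / M t))"
      using False assms(1,2) pos by (intro mult_left_mono Youngs_inequality_0) auto
    finally show ?thesis .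
  qed simp
  have "M ?r = (\<Sum>x\<in>cube n. \<bar>g x\<bar> powr ?r) / 2 ^ n" by (simp add: M_def)
  also have "\<dots> \<le> (\<Sum>x\<in>cube n. ?C * (l * (\<bar>g x\<bar> powr s / M s) + (1 - l) * (\<bar>g x\<bar> powr t / M t))) / 2 ^ n"
    by (intro divide_right_mono sum_mono young) simp
  also have "\<dots> = ?C * (l * (M s / M s) + (1 - l) * (M t / M t))"
  proof -
    have "(\<Sum>x\<in>cube n. c * (l * (\<bar>g x\<bar> powr s / a) + (1 - l) * (\<bar>g x\<bar> powr t / b))) / 2 ^ n
      = c * (l * (M s / a) + (1 - l) * (M t / b))" for a b c
      unfolding M_def
      by (simp add: sum_distrib_left sum_divide_distrib distrib_left add_divide_distrib sum.distrib mult_ac)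
    then show ?thesis .
  qed
  also have "\<dots> = ?C" using pos[of s] pos[of t] by simp
  finally show ?thesis .
qed

lemma cube_norm_interpolation:
  assumes q: "0 < q" "q < 2" and s: "q \<le> s" "s \<le> 2"
  defines "\<theta> \<equiv> q * (2 - s) / (s * (2 - q))"
  shows "(cube_norm n s g)\<^sup>2 \<le> ((cube_norm n 2 g)\<^sup>2) powr (1 - \<theta>) * ((cube_norm n q g)\<^sup>2) powr \<theta>"
proof -
  define M where "M t = (\<Sum>x\<in>cube n. \<bar>g x\<bar> powr t) / 2 ^ n" for t
  define l where "l = (2 - s) / (2 - q)"
  have l: "0 \<le> l" "l \<le> 1" using q s by (auto simp: l_def)
  have l2: "l * (2 - q) = 2 - s" using q by (simp add: l_def)
  have sl: "l * q + (1 - l) * 2 = s" using l2 by (simp add: algebra_simps)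
  have e1: "l * (2 / s) = 2 / q * \<theta>" using q s by (simp add: \<theta>_def l_def mult_ac)
  have e2: "(1 - l) * (2 / s) = 1 - \<theta>"
  proof -
    have "(1 - l) * 2 = s - l * q" using sl by simp
    then have "(1 - l) * (2 / s) = (s - l * q) / s" by (metis times_divide_eq_right)
    also have "\<dots> = 1 - l * q / s" using q s by (simp add: diff_divide_distrib)
    also have "l * q / s = \<theta>" by (simp add: \<theta>_def l_def mult_ac)
    finally show ?thesis .
  qed
  have "(cube_norm n s g)\<^sup>2 = M s powr (2 / s)"
    using q s by (simp add: cube_norm_sq M_def)
  also have "\<dots> \<le> (M q powr l * M 2 powr (1 - l)) powr (2 / s)"
    using moment_log_convex[OF l, where n = n and g = g and s = q and t = 2, unfolded sl, folded M_def] q s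
    by (intro powr_mono2) (auto simp: M_def sum_nonneg)
  also have "\<dots> = M q powr (2 / q * \<theta>) * M 2 powr (1 - \<theta>)"
    unfolding powr_mult powr_powr e1 e2 ..
  also have "\<dots> = ((cube_norm n 2 g)\<^sup>2) powr (1 - \<theta>) * ((cube_norm n q g)\<^sup>2) powr \<theta>"
    using q by (simp add: cube_norm_sq M_def powr_powr sum_nonneg)
  finally show ?thesis .
qed

lemma noise_energy_mono:
  "0 \<le> r \<Longrightarrow> r \<le> s \<Longrightarrow> noise_energy n r g \<le> noise_energy n s g"
  unfolding noise_energy_def by (intro sum_mono mult_right_mono power_mono) auto

lemma noise_energy_le_norm_2:
  "0 \<le> r \<Longrightarrow> r \<le> 1 \<Longrightarrow> noise_energy n r g \<le> (cube_norm n 2 g)\<^sup>2"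
  using noise_energy_mono[of r 1 n g] cube_hypercontractivity[of 1 n g] by simp

text \<open>
  Hypercontractivity bounds the energy at \<open>1 - u\<close> by
  the norm with exponent \<open>s = 2 - u\<close>. While \<open>q \<le> s\<close>, that norm is interpolated between \<open>L\<^sup>q\<close> and \<open>L\<^sup>2\<close>; the
  weight of \<open>L\<^sup>q\<close> is \<open>2 * a * u / (2 - u)\<close>. For smaller \<open>s\<close> the energy is at most its value at \<open>s = q\<close>, which is
  where the weight reaches \<open>1\<close>; hence the minimum.
\<close>
lemma noise_energy_decay:
  assumes q: "1 \<le> q" "q < 2" and u: "0 \<le> u" "u \<le> 1"
    and P: "(cube_norm n 2 g)\<^sup>2 \<le> P" "0 < P" and N: "0 < cube_norm n q g"
  defines "a \<equiv> q / (2 * (2 - q))"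
  shows "noise_energy n (1 - u) g
    \<le> P * exp (- (ln_plus (P / (cube_norm n q g)\<^sup>2) * min 1 (2 * a * u / (2 - u))))"
proof (cases "ln (P / (cube_norm n q g)\<^sup>2) \<le> 0")
  case True
  then show ?thesis
    using noise_energy_le_norm_2[of "1 - u" n g] u P by (simp add: ln_plus_def max_def)
next
  case False
  define N' where "N' = (cube_norm n q g)\<^sup>2"
  define L where "L = ln (P / N')"
  define \<theta> where "\<theta> = 2 * a * u / (2 - u)"
  have N': "0 < N'" using N by (simp add: N'_def)
  have L: "0 < L" "ln_plus (P / N') = L" using False by (auto simp: L_def N'_def ln_plus_def)
  have \<theta>_alt: "\<theta> = q * u / ((2 - u) * (2 - q))"
  proof -
    have "2 * a = q / (2 - q)" using q by (simp add: a_def field_simps)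
    then show ?thesis by (simp add: \<theta>_def mult_ac)
  qed
  have N'_eq: "N' = P * exp (- L)" using N' P by (simp add: L_def exp_minus)
  have powr_N': "P powr (1 - t) * N' powr t = P * exp (- (L * t))" for t
    using P N' by (simp add: N'_eq powr_mult exp_powr_real powr_diff)
  have "noise_energy n (1 - u) g \<le> P * exp (- (L * min 1 \<theta>))"
  proof (cases "u \<le> 2 - q")
    case True
    have "q * u \<le> (2 - u) * (2 - q)"
      using True by (simp add: algebra_simps)
    then have \<theta>: "\<theta> \<le> 1" unfolding \<theta>_alt using q u by (simp add: divide_le_eq_1)
    have "noise_energy n (1 - u) g \<le> (cube_norm n (2 - u) g)\<^sup>2"
      using cube_hypercontractivity[of "1 - u" n g] u by simp
    also have "\<dots> \<le> ((cube_norm n 2 g)\<^sup>2) powr (1 - \<theta>) * N' powr \<theta>"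
      using cube_norm_interpolation[of q "2 - u" n g] q u True by (simp add: \<theta>_alt N'_def)
    also have "\<dots> \<le> P powr (1 - \<theta>) * N' powr \<theta>"
      using P \<theta> by (intro mult_right_mono powr_mono2) auto
    finally show ?thesis using \<theta> by (simp add: powr_N' min_absorb2)
  next
    case False
    then have "(2 - u) * (2 - q) \<le> q * u" by (simp add: algebra_simps)
    then have \<theta>: "1 \<le> \<theta>" unfolding \<theta>_alt using q u by (simp add: le_divide_eq_1)
    \<comment> \<open>The parameter \<open>q - 1\<close> is the one for which hypercontractivity gives exactly the \<open>L\<^sup>q\<close> norm.\<close>
    have "noise_energy n (1 - u) g \<le> noise_energy n (q - 1) g"
      using u False by (intro noise_energy_mono) auto
    also have "\<dots> \<le> N'" using cube_hypercontractivity[of "q - 1" n g] q by (simp add: N'_def)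
    finally show ?thesis using \<theta> by (simp add: N'_eq)
  qed
  then show ?thesis using L by (simp add: \<theta>_def N'_def)
qed

text \<open>
  This is where boundedness by \<open>1\<close> enters: it makes the \<open>p\<close>-th moments decrease in \<open>p\<close>.
\<close>
lemma cube_norm_2_le_powr:
  assumes "p \<le> 2" "0 < p" and "\<And>x. x \<in> cube n \<Longrightarrow> \<bar>g x\<bar> \<le> 1"
  shows "(cube_norm n 2 g)\<^sup>2 \<le> cube_norm n p g powr p"
proof -
  have "(cube_norm n 2 g)\<^sup>2 = (\<Sum>x\<in>cube n. \<bar>g x\<bar> powr 2) / 2 ^ n"
    by (simp add: cube_norm_sq sum_nonneg)
  also have "\<dots> \<le> (\<Sum>x\<in>cube n. \<bar>g x\<bar> powr p) / 2 ^ n"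
    using assms by (intro divide_right_mono sum_mono powr_mono') auto
  finally show ?thesis using assms by (simp add: cube_norm_powr)
qed

section \<open>Integral inequalities\<close>

text \<open>
  This removes \<open>k\<close> from the problem. With \<open>A\<close> the primitive of \<open>F\<close>, the right-hand side is the integral of
  the derivative \<open>k * A x ^ (k - 1) * F x\<close> of \<open>A ^ k\<close>, and \<open>x * F x \<le> A x\<close> because \<open>F\<close> decreases.
\<close>
lemma power_weighted_integral_le:
  fixes F :: "real \<Rightarrow> real"
  assumes k: "1 \<le> k" and cont: "continuous_on {0..1} F"
    and anti: "\<And>x y. 0 \<le> x \<Longrightarrow> x \<le> y \<Longrightarrow> y \<le> 1 \<Longrightarrow> F y \<le> F x"
    and nonneg: "\<And>x. 0 \<le> x \<Longrightarrow> x \<le> 1 \<Longrightarrow> 0 \<le> F x"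
  shows "integral {0..1} (\<lambda>u. real k * u ^ (k - 1) * F u ^ k) \<le> (integral {0..1} F) ^ k"
proof -
  define A where "A x = integral {0..x} F" for x
  have A: "x * F x \<le> A x" if x: "0 \<le> x" "x \<le> 1" for x
  proof -
    have "integral {0..x} (\<lambda>_. F x) \<le> integral {0..x} F"
      using x anti cont
      by (intro integral_le integrable_continuous_real) (auto intro: continuous_on_subset)
    then show ?thesis using x by (simp add: A_def)
  qed
  have "((\<lambda>x. real k * A x ^ (k - 1) * F x) has_integral A 1 ^ k - A 0 ^ k) {0..1}"
  proof (rule fundamental_theorem_of_calculus)
    fix x :: real assume x: "x \<in> {0..1}"
    have "(A has_real_derivative F x) (at x within {0..1})"
      unfolding A_def has_real_derivative_iff_has_vector_derivative
      by (rule integral_has_vector_derivative[OF cont x])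
    from DERIV_power[OF this, of k]
    show "((\<lambda>x. A x ^ k) has_vector_derivative real k * A x ^ (k - 1) * F x) (at x within {0..1})"
      unfolding has_real_derivative_iff_has_vector_derivative[symmetric] by (simp add: mult_ac)
  qed simp
  moreover have "A 0 ^ k = 0" using k by (simp add: A_def)
  ultimately have A_int: "((\<lambda>x. real k * A x ^ (k - 1) * F x) has_integral A 1 ^ k) {0..1}" by simp
  have "integral {0..1} (\<lambda>u. real k * u ^ (k - 1) * F u ^ k) \<le> A 1 ^ k"
  proof (rule has_integral_le[OF integrable_integral A_int])
    show "(\<lambda>u. real k * u ^ (k - 1) * F u ^ k) integrable_on {0..1}"
      using cont by (intro integrable_continuous_real continuous_intros)
    fix x :: real assume x: "x \<in> {0..1}"
    have "real k * x ^ (k - 1) * F x ^ k = real k * (x * F x) ^ (k - 1) * F x"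
      using k by (cases k) (auto simp: power_mult_distrib)
    also have "\<dots> \<le> real k * A x ^ (k - 1) * F x"
      using x A[of x] nonneg[of x] by (intro mult_right_mono mult_left_mono power_mono) auto
    finally show "real k * x ^ (k - 1) * F x ^ k \<le> real k * A x ^ (k - 1) * F x" .
  qed
  then show ?thesis by (simp add: A_def)
qed

lemma integral_le_antiderivative:
  fixes f \<Phi> :: "real \<Rightarrow> real"
  assumes "\<alpha> \<le> \<beta>" and "continuous_on {\<alpha>..\<beta>} f"
    and D: "\<And>x. \<alpha> \<le> x \<Longrightarrow> x \<le> \<beta> \<Longrightarrow> (\<Phi> has_real_derivative \<Phi>' x) (at x)"
    and le: "\<And>x. \<alpha> \<le> x \<Longrightarrow> x \<le> \<beta> \<Longrightarrow> f x \<le> \<Phi>' x"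
  shows "integral {\<alpha>..\<beta>} f \<le> \<Phi> \<beta> - \<Phi> \<alpha>"
proof (rule has_integral_le[OF integrable_integral])
  show "(\<Phi>' has_integral \<Phi> \<beta> - \<Phi> \<alpha>) {\<alpha>..\<beta>}"
    using assms(1) D by (intro fundamental_theorem_of_calculus)
      (auto simp flip: has_real_derivative_iff_has_vector_derivative intro: has_field_derivative_at_within)
qed (use assms in \<open>auto intro: integrable_continuous_real\<close>)

text \<open>
  With \<open>c = a * m\<close> this is \<open>m\<close> times the interpolation weight \<open>2 * a * u / (2 - u)\<close> of \<open>noise_energy_decay\<close>.
\<close>
definition decay_exponent :: "real \<Rightarrow> real \<Rightarrow> real" where
  "decay_exponent c u = 2 * c * u / (2 - u)"

text \<open>
  Write \<open>w\<close> for the exponent. Integration by parts turns the integral of \<open>(1 + c) * exp (- w)\<close> over \<open>u\<close> into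
  the boundary term \<open>(1 + c) * u * exp (- w)\<close> plus the integral of \<open>(1 + c) * u * exp (- w)\<close> over \<open>w\<close>. Here
  \<open>(1 + c) * u\<close> is at most \<open>w\<close> once \<open>2 \<le> w\<close>, and at most \<open>w + (2 * w - w\<^sup>2) / (2 * c)\<close> while \<open>w \<le> 2\<close>. Multiplied by
  \<open>exp (- w)\<close>, these bounds have the primitives \<open>- (1 + w) * exp (- w)\<close>, respectively the same with
  \<open>w\<^sup>2 / (2 * c) * exp (- w)\<close> added.
\<close>
definition late_primitive :: "real \<Rightarrow> real \<Rightarrow> real" where
  "late_primitive c u = ((1 + c) * u - (1 + decay_exponent c u)) * exp (- decay_exponent c u)"

definition early_primitive :: "real \<Rightarrow> real \<Rightarrow> real" where
  "early_primitive c u = late_primitive c u + (decay_exponent c u)\<^sup>2 / (2 * c) * exp (- decay_exponent c u)"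

context
  fixes c :: real
  assumes c: "0 < c"
begin

lemma decay_exponent_deriv:
  "u < 2 \<Longrightarrow> (decay_exponent c has_real_derivative 4 * c / (2 - u)\<^sup>2) (at u)"
  unfolding decay_exponent_def
  by (auto intro!: derivative_eq_intros simp: power2_eq_square field_simps)

lemma late_primitive_deriv:
  assumes "u < 2"
  shows "(late_primitive c has_real_derivative
    exp (- decay_exponent c u) * ((1 + c) + 4 * c / (2 - u)\<^sup>2 * (decay_exponent c u - (1 + c) * u))) (at u)"
proof -
  define d where "d = 4 * c / (2 - u)\<^sup>2"
  have D: "(decay_exponent c has_real_derivative d) (at u)"
    unfolding d_def by (rule decay_exponent_deriv[OF assms])
  show ?thesis
    unfolding late_primitive_def d_def[symmetric]
    by (rule DERIV_cong, (rule derivative_eq_intros D refl)+) (simp add: algebra_simps)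
qed

lemma early_primitive_deriv:
  assumes "u < 2"
  shows "(early_primitive c has_real_derivative
    exp (- decay_exponent c u) * ((1 + c) + 4 * c / (2 - u)\<^sup>2 *
      (decay_exponent c u - (1 + c) * u + (2 * decay_exponent c u - (decay_exponent c u)\<^sup>2) / (2 * c)))) (at u)"
proof -
  define d K where "d = 4 * c / (2 - u)\<^sup>2" and "K = 1 / (2 * c)"
  have D: "(decay_exponent c has_real_derivative d) (at u)"
    unfolding d_def by (rule decay_exponent_deriv[OF assms])
  have K: "x / (2 * c) = x * K" for x by (simp add: K_def)
  note L = late_primitive_deriv[OF assms, folded d_def]
  show ?thesis
    unfolding early_primitive_def d_def[symmetric] K
    by (rule DERIV_cong, (rule derivative_eq_intros D L refl)+) (simp add: algebra_simps power2_eq_square)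
qed

lemma linear_le_decay_exponent_late:
  assumes u: "0 \<le> u" "u \<le> 1" and w: "2 \<le> decay_exponent c u"
  shows "(1 + c) * u \<le> decay_exponent c u"
proof -
  have "2 - u \<le> c * u" using w u by (simp add: decay_exponent_def field_simps)
  then have "(1 + c) * (2 - u) \<le> 2 * c" by (simp add: algebra_simps)
  then have "u * ((1 + c) * (2 - u)) \<le> u * (2 * c)" using u by (intro mult_left_mono) auto
  then show ?thesis using u by (simp add: decay_exponent_def field_simps)
qed

lemma linear_le_decay_exponent_early:
  assumes u: "0 \<le> u" "u \<le> 1" and w: "decay_exponent c u \<le> 2"
  shows "(1 + c) * u \<le> decay_exponent c u + (2 * decay_exponent c u - (decay_exponent c u)\<^sup>2) / (2 * c)"
proof -
  have cu: "c * u \<le> 2 - u" using w u by (simp add: decay_exponent_def field_simps)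
  define v where "v = 2 - u"
  have v: "0 < v" using u by (simp add: v_def)
  have "(2 * c * u * v + 2 * u * v - 2 * c * u\<^sup>2) - (1 + c) * u * v\<^sup>2 = u\<^sup>2 * (2 - u - c * u)"
    unfolding v_def by (simp add: power2_eq_square algebra_simps)
  also have "\<dots> \<ge> 0" using cu by simp
  finally have "(1 + c) * u \<le> (2 * c * u * v + 2 * u * v - 2 * c * u\<^sup>2) / v\<^sup>2"
    using v by (simp add: pos_le_divide_eq)
  also have "\<dots> = decay_exponent c u + (2 * decay_exponent c u - (decay_exponent c u)\<^sup>2) / (2 * c)"
    unfolding decay_exponent_def v_def[symmetric] using v c by (simp add: field_simps power2_eq_square)
  finally show ?thesis .
qed

lemma decay_exponent_mono:
  assumes "0 \<le> u" "u \<le> v" "v \<le> 1" shows "decay_exponent c u \<le> decay_exponent c v"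
  unfolding decay_exponent_def using assms c by (intro frac_le) auto

lemma continuous_on_exp_decay: "S \<subseteq> {0..1} \<Longrightarrow> continuous_on S (\<lambda>u. exp (- decay_exponent c u))"
  unfolding decay_exponent_def by (intro continuous_intros) auto

lemma integral_exp_decay_early:
  assumes "0 \<le> \<alpha>" "\<alpha> \<le> \<beta>" "\<beta> \<le> 1" "decay_exponent c \<beta> \<le> 2"
  shows "integral {\<alpha>..\<beta>} (\<lambda>u. (1 + c) * exp (- decay_exponent c u)) \<le> early_primitive c \<beta> - early_primitive c \<alpha>"
proof (rule integral_le_antiderivative[OF assms(2)])
  show "continuous_on {\<alpha>..\<beta>} (\<lambda>u. (1 + c) * exp (- decay_exponent c u))"
    using assms by (intro continuous_intros continuous_on_exp_decay) auto
  fix u assume u: "\<alpha> \<le> u" "u \<le> \<beta>"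
  show "(early_primitive c has_real_derivative
    exp (- decay_exponent c u) * ((1 + c) + 4 * c / (2 - u)\<^sup>2 *
      (decay_exponent c u - (1 + c) * u + (2 * decay_exponent c u - (decay_exponent c u)\<^sup>2) / (2 * c)))) (at u)"
    using u assms by (intro early_primitive_deriv) auto
  have "decay_exponent c u \<le> 2" using decay_exponent_mono[of u \<beta>] u assms by auto
  then have "0 \<le> decay_exponent c u - (1 + c) * u + (2 * decay_exponent c u - (decay_exponent c u)\<^sup>2) / (2 * c)"
    using linear_le_decay_exponent_early[of u] u assms by auto
  then show "(1 + c) * exp (- decay_exponent c u) \<le> exp (- decay_exponent c u) * ((1 + c) + 4 * c / (2 - u)\<^sup>2 *
      (decay_exponent c u - (1 + c) * u + (2 * decay_exponent c u - (decay_exponent c u)\<^sup>2) / (2 * c)))"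
    using c by (subst mult.commute, intro mult_left_mono) auto
qed

lemma integral_exp_decay_late:
  assumes "0 \<le> \<alpha>" "\<alpha> \<le> \<beta>" "\<beta> \<le> 1" "2 \<le> decay_exponent c \<alpha>"
  shows "integral {\<alpha>..\<beta>} (\<lambda>u. (1 + c) * exp (- decay_exponent c u)) \<le> late_primitive c \<beta> - late_primitive c \<alpha>"
proof (rule integral_le_antiderivative[OF assms(2)])
  show "continuous_on {\<alpha>..\<beta>} (\<lambda>u. (1 + c) * exp (- decay_exponent c u))"
    using assms by (intro continuous_intros continuous_on_exp_decay) auto
  fix u assume u: "\<alpha> \<le> u" "u \<le> \<beta>"
  show "(late_primitive c has_real_derivative
    exp (- decay_exponent c u) * ((1 + c) + 4 * c / (2 - u)\<^sup>2 * (decay_exponent c u - (1 + c) * u))) (at u)"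
    using u assms by (intro late_primitive_deriv) auto
  have "2 \<le> decay_exponent c u" using decay_exponent_mono[of \<alpha> u] u assms by auto
  then have "0 \<le> decay_exponent c u - (1 + c) * u"
    using linear_le_decay_exponent_late[of u] u assms by auto
  then show "(1 + c) * exp (- decay_exponent c u)
    \<le> exp (- decay_exponent c u) * ((1 + c) + 4 * c / (2 - u)\<^sup>2 * (decay_exponent c u - (1 + c) * u))"
    using c by (subst mult.commute, intro mult_left_mono) auto
qed

end

text \<open>
  The maximum of \<open>m * exp (- m)\<close>, the source of the number \<open>e\<close> in the constant \<open>Cconst q\<close>.
\<close>
lemma mult_exp_minus_le: "m * exp (- m) \<le> exp (-1 :: real)"
proof -
  have "m \<le> exp (m - 1)" using exp_ge_add_one_self[of "m - 1"] by simp
  then have "m * exp (- m) \<le> exp (m - 1) * exp (- m)" by (intro mult_right_mono) auto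
  then show ?thesis by (simp flip: exp_add)
qed

text \<open>
  What remains of the integral bound for \<open>2 \<le> m\<close> once the boundary terms are added up. Since
  \<open>m * exp (- m) \<le> exp (- 1)\<close>, the worst case is \<open>a = 1 / 2\<close>, where the claim reads
  \<open>8 / e \<le> m + m\<^sup>2 * exp (1 - m)\<close>. The first summand suffices for \<open>3 \<le> m\<close>; below that, the tangent of the
  exponential at \<open>m = 2\<close> leaves a polynomial inequality.
\<close>
lemma exp_remainder_bound:
  fixes a m :: real
  assumes a: "1 / 2 \<le> a" and m: "2 \<le> m"
  shows "(a - 1) * (m * exp (- m)) + 2 / (a * m) * exp (- 2) \<le> a * exp (- 1)"
proof -
  define x where "x = m * exp (- m)"
  have e: "27 / 10 \<le> exp (1 :: real)" using e_approx_32 by (simp add: abs_if split: if_splits)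
  have "8 / exp 1 \<le> m + m * x * exp 1"
  proof (cases "m \<le> 3")
    case True
    have "1 + (2 - m) \<le> exp (2 - m)" by (rule exp_ge_add_one_self)
    then have "m\<^sup>2 * (3 - m) \<le> m\<^sup>2 * exp (2 - m)" by (intro mult_left_mono) auto
    moreover have "exp (2 - m) = exp (- m) * exp 1 * exp 1"
      by (simp flip: exp_add)
    ultimately have 1: "m\<^sup>2 * (3 - m) \<le> m * x * exp 1 * exp 1"
      by (simp add: x_def power2_eq_square mult_ac)
    have "0 \<le> (3 - m) * (m\<^sup>2 - 27 / 10)"
      using True m mult_mono[of 2 m 2 m] by (intro mult_nonneg_nonneg) (auto simp: power2_eq_square)
    also have "\<dots> = 27 / 10 * m + m\<^sup>2 * (3 - m) - 81 / 10" by (simp add: field_simps)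
    finally have "8 \<le> 27 / 10 * m + m\<^sup>2 * (3 - m)" by linarith
    also have "27 / 10 * m \<le> exp 1 * m" using e m by (intro mult_right_mono) auto
    finally have "8 \<le> (m + m * x * exp 1) * exp 1" using 1 by (simp add: algebra_simps)
    then show ?thesis by (simp add: divide_le_eq)
  next
    case False
    have "8 / exp 1 \<le> 8 / (27 / 10 :: real)" using e by (intro divide_left_mono) auto
    also have "\<dots> \<le> m" using False by simp
    also have "\<dots> \<le> m + m * x * exp 1" using m by (simp add: x_def)
    finally show ?thesis .
  qed
  then have "8 / exp 1 / (m * exp 1) \<le> (m + m * x * exp 1) / (m * exp 1)"
    using m by (intro divide_right_mono) auto
  moreover have "8 / exp 1 / (m * exp 1) = 8 / m * exp (- 2 :: real)"
    using exp_add[of 1 "1::real"] by (simp add: exp_minus field_simps)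
  moreover have "(m + m * x * exp 1) / (m * exp 1) = exp (- 1) + x"
    using m by (simp add: exp_minus field_simps)
  ultimately have key: "4 / m * exp (- 2) \<le> (exp (- 1) + x) / 2" by simp
  have "2 / (a * m) \<le> 2 / (1 / 2 * m)"
    using a m by (intro divide_left_mono mult_right_mono mult_pos_pos) auto
  then have "2 / (a * m) * exp (- 2) \<le> 4 / m * exp (- 2)" by (intro mult_right_mono) auto
  then have "2 / (a * m) * exp (- 2) \<le> (exp (- 1) + x) / 2" using key by linarith
  moreover have "0 \<le> (a - 1 / 2) * (exp (- 1) - x)"
    using a mult_exp_minus_le[of m] by (simp add: x_def)
  ultimately show ?thesis unfolding x_def[symmetric] left_diff_distrib right_diff_distrib by simp
qed

text \<open>
  The case \<open>k = 1\<close> of the problem, and the origin of the constant: on the plateau alone, where the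
  minimum is \<open>1\<close>, the bound is \<open>(1 + a * m) * exp (- m) \<le> 1 + a / e\<close>. The lower bound \<open>1 / 2\<close> on \<open>a\<close> is the value for
  \<open>q = 1\<close>. The convexity of \<open>2 * a * u / (2 - u)\<close> in \<open>u\<close> has to be exploited: with its tangent \<open>a * u\<close> at \<open>0\<close> in
  its place the inequality fails for \<open>a = 1 / 2\<close> and \<open>m = 2\<close>.
\<close>
lemma decay_integral_bound:
  fixes a m :: real
  assumes a: "1 / 2 \<le> a" and m: "0 \<le> m"
  shows "(1 + a * m) * integral {0..1} (\<lambda>u. exp (- (m * min 1 (2 * a * u / (2 - u)))))
    \<le> 1 + a * exp (- 1)"
proof (cases "m = 0")
  case True
  then show ?thesis using a by simp
next
  case False
  define c where "c = a * m"
  have c: "0 < c" using a m False by (simp add: c_def)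
  define F where "F u = exp (- (m * min 1 (2 * a * u / (2 - u))))" for u
  define w where "w = decay_exponent c"
  have contF: "continuous_on {0..1} F"
    unfolding F_def by (intro continuous_intros) auto
  \<comment> \<open>The plateau starts at \<open>u0\<close>, the solution of \<open>2 * a * u / (2 - u) = 1\<close>.\<close>
  define u0 where "u0 = 2 / (1 + 2 * a)"
  have u0: "0 < u0" "u0 \<le> 1" using a by (auto simp: u0_def)
  have w0: "w 0 = 0" by (simp add: w_def decay_exponent_def)
  have u0_eq: "2 - u0 = 2 * a * u0" using a by (simp add: u0_def field_simps)
  then have wu0: "w u0 = m"
    using a u0 by (simp add: w_def decay_exponent_def c_def)
  have w_eq: "w u = m * (2 * a * u / (2 - u))" for u
    by (simp add: w_def decay_exponent_def c_def)
  have threshold: "2 * a * u / (2 - u) \<le> 1 \<longleftrightarrow> u \<le> u0" if "u \<le> 1" for u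
    using that a by (auto simp: u0_def field_simps)
  have F_early: "F u = exp (- w u)" if "0 \<le> u" "u \<le> u0" for u
    using threshold[of u] that u0 by (simp add: F_def w_eq min_absorb2)
  have F_late: "F u = exp (- m)" if "u0 \<le> u" "u \<le> 1" for u
    using threshold[of u] u0_eq that u0 a
    by (cases "u = u0") (auto simp: F_def min_def)
  let ?L = "late_primitive c" and ?E = "early_primitive c"
  have start: "?E 0 = - 1"
    by (simp add: early_primitive_def late_primitive_def w0 flip: w_def)
  have stop: "?L u0 = ((1 + c) * u0 - (1 + m)) * exp (- m)"
    by (simp add: late_primitive_def wu0 flip: w_def)
  have early: "integral {0..u0} (\<lambda>u. (1 + c) * exp (- w u))
    \<le> 1 + (1 + c) * u0 * exp (- m) + a * exp (- 1) - (1 + c) * exp (- m)"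
  proof (cases "m \<le> 2")
    case True
    have "integral {0..u0} (\<lambda>u. (1 + c) * exp (- w u)) \<le> ?E u0 - ?E 0"
      unfolding w_def using u0 wu0 True
      by (intro integral_exp_decay_early[OF c]) (auto simp: w_def)
    also have "\<dots> = ?L u0 + m / (2 * a) * exp (- m) + 1"
    proof -
      have "?E u0 = ?L u0 + m\<^sup>2 / (2 * c) * exp (- m)"
        by (simp add: early_primitive_def wu0[unfolded w_def])
      also have "m\<^sup>2 / (2 * c) = m / (2 * a)" using a False by (simp add: c_def power2_eq_square)
      finally show ?thesis by (simp add: start)
    qed
    also have "m / (2 * a) * exp (- m) \<le> m * exp (- m)"
      using a m by (intro mult_right_mono) (auto simp: divide_le_eq mult_le_cancel_left1)
    finally have *: "integral {0..u0} (\<lambda>u. (1 + c) * exp (- w u)) \<le> ?L u0 + m * exp (- m) + 1"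
      by simp
    have "a * (m * exp (- m)) \<le> a * exp (- 1)"
      using a by (intro mult_left_mono mult_exp_minus_le) auto
    then have "c * exp (- m) \<le> a * exp (- 1)" by (simp add: c_def mult.assoc)
    then show ?thesis using * unfolding stop left_diff_distrib distrib_right by simp
  next
    case m2: False
    \<comment> \<open>At \<open>u1\<close> the exponent equals \<open>2\<close>, where the bound for the integrand changes.\<close>
    define u1 where "u1 = 2 / (1 + c)"
    have "1 + 2 * a \<le> 1 + c" using m2 a mult_left_mono[of 2 m a] by (simp add: c_def)
    then have u1: "0 < u1" "u1 \<le> u0" using c a by (auto simp: u1_def u0_def frac_le)
    have "2 - u1 = c * u1" using c by (simp add: u1_def field_simps)
    then have wu1: "w u1 = 2" using c u1 by (simp add: w_def decay_exponent_def)
    have "integral {0..u0} (\<lambda>u. (1 + c) * exp (- w u))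
      = integral {0..u1} (\<lambda>u. (1 + c) * exp (- w u)) + integral {u1..u0} (\<lambda>u. (1 + c) * exp (- w u))"
      using u0 u1 continuous_on_exp_decay[OF c, of "{0..u0}"]
      by (intro Henstock_Kurzweil_Integration.integral_combine[symmetric] integrable_continuous_real
          continuous_on_mult_left) (auto simp: w_def)
    also have "\<dots> \<le> (?E u1 - ?E 0) + (?L u0 - ?L u1)"
      unfolding w_def using u0 u1 wu1
      by (intro add_mono integral_exp_decay_early[OF c] integral_exp_decay_late[OF c])
        (auto simp: w_def)
    also have "\<dots> = ?L u0 + 2 / c * exp (- 2) + 1"
    proof -
      have "?E u1 = ?L u1 + 2 / c * exp (- 2)"
        by (simp add: early_primitive_def wu1[unfolded w_def])
      then show ?thesis by (simp add: start)
    qed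
    finally have *: "integral {0..u0} (\<lambda>u. (1 + c) * exp (- w u)) \<le> ?L u0 + 2 / c * exp (- 2) + 1" .
    have "(a - 1) * (m * exp (- m)) + 2 / c * exp (- 2) \<le> a * exp (- 1)"
      unfolding c_def using m2 by (intro exp_remainder_bound[OF a]) simp
    moreover have "(a - 1) * (m * exp (- m)) = c * exp (- m) - m * exp (- m)"
      by (simp add: c_def algebra_simps)
    ultimately have "c * exp (- m) - m * exp (- m) + 2 / c * exp (- 2) \<le> a * exp (- 1)" by simp
    then show ?thesis using * unfolding stop left_diff_distrib distrib_right by simp
  qed
  have "(1 + c) * integral {0..1} F = integral {0..1} (\<lambda>u. (1 + c) * F u)" by simp
  also have "\<dots> = integral {0..u0} (\<lambda>u. (1 + c) * F u) + integral {u0..1} (\<lambda>u. (1 + c) * F u)"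
    using u0 contF
    by (intro Henstock_Kurzweil_Integration.integral_combine[symmetric] integrable_continuous_real
        continuous_on_mult_left) auto
  also have "integral {0..u0} (\<lambda>u. (1 + c) * F u) = integral {0..u0} (\<lambda>u. (1 + c) * exp (- w u))"
    by (intro integral_cong) (auto simp: F_early)
  also have "integral {u0..1} (\<lambda>u. (1 + c) * F u) = integral {u0..1} (\<lambda>u. (1 + c) * exp (- m))"
    by (intro integral_cong) (auto simp: F_late)
  also have "\<dots> = (1 + c) * exp (- m) * (1 - u0)" using u0 by simp
  finally have "(1 + c) * integral {0..1} F \<le> 1 + a * exp (- 1)"
    using early by (simp add: algebra_simps)
  then show ?thesis unfolding c_def F_def[abs_def] .
qed

section \<open>The lower bound for the gradient sum\<close>

lemma Cconst_eq: "Cconst q = 1 / (1 + q / (2 * (2 - q)) * exp (- 1))"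
  by (simp add: Cconst_def exp_minus field_simps)

text \<open>
  The contribution of one derivative. The decay bound has the form \<open>P * F u ^ k\<close> with a decreasing \<open>F\<close>, for
  \<open>m\<close> the logarithm divided by \<open>k\<close>; this division turns the factor \<open>1 + a * m\<close> of the one-dimensional bound
  into the bracket of the theorem.
\<close>
lemma noise_energy_integral_le:
  assumes q: "1 \<le> q" "q < 2" and k: "1 \<le> k"
    and P: "(cube_norm n 2 g)\<^sup>2 \<le> P" "0 < P" and N: "0 < cube_norm n q g"
  shows "Cconst q ^ k * integral {0..1} (\<lambda>u. real k * u ^ (k - 1) * noise_energy n (1 - u) g)
    \<le> P / (1 + q / (2 * real k * (2 - q)) * ln_plus (P / (cube_norm n q g)\<^sup>2)) ^ k"
proof -
  define L where "L = ln_plus (P / (cube_norm n q g)\<^sup>2)"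
  define m where "m = L / real k"
  define a where "a = q / (2 * (2 - q))"
  define F where "F u = exp (- (m * min 1 (2 * a * u / (2 - u))))" for u
  have a: "1 / 2 \<le> a" using q by (simp add: a_def field_simps)
  have m: "0 \<le> m" by (simp add: m_def L_def ln_plus_def)
  have am: "q / (2 * real k * (2 - q)) * L = a * m" by (simp add: a_def m_def)
  have C: "Cconst q * (1 + a * exp (- 1)) = 1" "0 \<le> Cconst q"
  proof -
    have "0 < 1 + a * exp (- 1)" using a by (intro add_pos_nonneg mult_nonneg_nonneg) auto
    then show "Cconst q * (1 + a * exp (- 1)) = 1" "0 \<le> Cconst q"
      unfolding Cconst_eq a_def[symmetric] by auto
  qed
  have contF: "continuous_on {0..1} F"
    unfolding F_def by (intro continuous_intros) auto
  have antiF: "F y \<le> F x" if "0 \<le> x" "x \<le> y" "y \<le> 1" for x y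
  proof -
    have "2 * a * x / (2 - x) \<le> 2 * a * y / (2 - y)"
      using that a by (intro frac_le mult_left_mono) auto
    then show ?thesis unfolding F_def using m by (auto intro!: mult_left_mono min.mono)
  qed
  have F_pow: "F u ^ k = exp (- (L * min 1 (2 * a * u / (2 - u))))" for u
    using k by (simp add: F_def m_def flip: exp_of_nat_mult)
  have "integral {0..1} (\<lambda>u. real k * u ^ (k - 1) * noise_energy n (1 - u) g)
    \<le> integral {0..1} (\<lambda>u. P * (real k * u ^ (k - 1) * F u ^ k))"
  proof (rule integral_le)
    show "(\<lambda>u. real k * u ^ (k - 1) * noise_energy n (1 - u) g) integrable_on {0..1}"
      unfolding noise_energy_def by (intro integrable_continuous_real continuous_intros)
    show "(\<lambda>u. P * (real k * u ^ (k - 1) * F u ^ k)) integrable_on {0..1}"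
      using contF by (intro integrable_continuous_real continuous_intros)
    fix u :: real assume u: "u \<in> {0..1}"
    then have "noise_energy n (1 - u) g \<le> P * F u ^ k"
      using noise_energy_decay[OF q _ _ P N, of u] by (simp add: F_pow a_def L_def)
    then have "real k * u ^ (k - 1) * noise_energy n (1 - u) g \<le> real k * u ^ (k - 1) * (P * F u ^ k)"
      using u by (intro mult_left_mono) auto
    then show "real k * u ^ (k - 1) * noise_energy n (1 - u) g \<le> P * (real k * u ^ (k - 1) * F u ^ k)"
      by (simp add: mult_ac)
  qed
  also have "\<dots> = P * integral {0..1} (\<lambda>u. real k * u ^ (k - 1) * F u ^ k)" by simp
  also have "\<dots> \<le> P * (integral {0..1} F) ^ k"
    using P by (intro mult_left_mono power_weighted_integral_le k contF antiF) (auto simp: F_def)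
  finally have I: "integral {0..1} (\<lambda>u. real k * u ^ (k - 1) * noise_energy n (1 - u) g)
    \<le> P * (integral {0..1} F) ^ k" .
  have "(1 + a * m) * integral {0..1} F \<le> 1 + a * exp (- 1)"
    unfolding F_def[abs_def] by (rule decay_integral_bound[OF a m])
  then have "Cconst q * ((1 + a * m) * integral {0..1} F) \<le> 1"
    using C mult_left_mono by metis
  moreover have "0 < 1 + a * m" using a m by (intro add_pos_nonneg mult_nonneg_nonneg) auto
  ultimately have "Cconst q * integral {0..1} F \<le> 1 / (1 + a * m)"
    by (simp add: pos_le_divide_eq mult_ac)
  moreover have "0 \<le> integral {0..1} F"
    using contF by (intro integral_nonneg integrable_continuous_real) (auto simp: F_def)
  ultimately have *: "(Cconst q * integral {0..1} F) ^ k \<le> (1 / (1 + a * m)) ^ k"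
    using C by (intro power_mono) auto
  have "Cconst q ^ k * integral {0..1} (\<lambda>u. real k * u ^ (k - 1) * noise_energy n (1 - u) g)
    \<le> Cconst q ^ k * (P * (integral {0..1} F) ^ k)"
    using I C by (intro mult_left_mono) auto
  also have "\<dots> = P * (Cconst q * integral {0..1} F) ^ k" by (simp add: power_mult_distrib)
  also have "\<dots> \<le> P * (1 / (1 + a * m)) ^ k" using * P by (intro mult_left_mono) auto
  also have "\<dots> = P / (1 + q / (2 * real k * (2 - q)) * L) ^ k" unfolding am by (simp add: power_divide)
  finally show ?thesis by (simp add: L_def)
qed

lemma Cconst_ge:
  assumes "1 \<le> q" "q < 2"
  shows "1 / 2 * (2 - q) \<le> Cconst q"
proof -
  have "q * 1 \<le> q * (2 * exp 1)" using assms exp_ge_add_one_self[of 1] by (intro mult_left_mono) auto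
  then have "q / (2 * exp 1) \<le> q" by (simp add: divide_le_eq)
  then have "(2 - q) * (1 + q / (2 * exp 1 * (2 - q))) \<le> 2"
    using assms by (simp add: distrib_left)
  moreover have "0 < 1 + q / (2 * exp 1 * (2 - q))" using assms by (intro add_pos_nonneg) auto
  ultimately show ?thesis
    unfolding Cconst_def by (simp add: inverse_eq_divide le_divide_eq mult_ac)
qed

theorem theorem1p3:
  shows "(\<forall>n::nat. n \<ge> 1 \<longrightarrow>
           (\<forall>k::nat. k \<le> n \<longrightarrow>
             (\<forall>(f :: (nat \<Rightarrow> real) \<Rightarrow> real) (p::real) (q::real).
               f \<in> cube n \<rightarrow> {-1..1} \<and> 1 \<le> p \<and> p \<le> 2 \<and> 1 \<le> q \<and> q < 2 \<longrightarrow>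
               (\<Sum>J | J \<subseteq> {1..n} \<and> card J = k.
                  cube_norm n p (disc_deriv_set J f) powr p /
                  (1 + q / (2 * real k * (2 - q)) *
                     ln_plus (cube_norm n p (disc_deriv_set J f) powr p /
                              (cube_norm n q (disc_deriv_set J f))\<^sup>2)) ^ k)
               \<ge> Cconst q ^ k * high_weight n k f)))
         \<and> (\<exists>c::real. c > 0 \<and> (\<forall>q::real. 1 \<le> q \<and> q < 2 \<longrightarrow> Cconst q \<ge> c * (2 - q)))"
proof (intro conjI allI impI)
  show "\<exists>c::real. c > 0 \<and> (\<forall>q::real. 1 \<le> q \<and> q < 2 \<longrightarrow> Cconst q \<ge> c * (2 - q))"
    using Cconst_ge by (intro exI[of _ "1 / 2"]) auto
next
  fix n k :: nat and f :: "(nat \<Rightarrow> real) \<Rightarrow> real" and p q :: real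
  assume "f \<in> cube n \<rightarrow> {-1..1} \<and> 1 \<le> p \<and> p \<le> 2 \<and> 1 \<le> q \<and> q < 2"
  then have p: "1 \<le> p" "p \<le> 2" and q: "1 \<le> q" "q < 2"
    and f: "\<And>x. x \<in> cube n \<Longrightarrow> \<bar>f x\<bar> \<le> 1"
    by (auto simp: Pi_iff abs_le_iff)
  define P where "P J = cube_norm n p (disc_deriv_set J f) powr p" for J
  have P_ge: "(cube_norm n 2 (disc_deriv_set J f))\<^sup>2 \<le> P J" if "J \<subseteq> {1..n}" for J
    unfolding P_def using p abs_disc_deriv_set_le[OF that f] by (intro cube_norm_2_le_powr) auto
  let ?\<J> = "{J. J \<subseteq> {1..n} \<and> card J = k}"
  let ?term = "\<lambda>J. P J / (1 + q / (2 * real k * (2 - q)) *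
    ln_plus (P J / (cube_norm n q (disc_deriv_set J f))\<^sup>2)) ^ k"
  have "Cconst q ^ k * high_weight n k f \<le> (\<Sum>J\<in>?\<J>. ?term J)"
  proof (cases "k = 0")
    case True
    then have "?\<J> = {{}}" using finite_subset[of _ "{1..n}"] by auto
    moreover have "high_weight n k f = noise_energy n 1 f"
      unfolding high_weight_fourier noise_energy_def True by (auto intro!: sum.cong)
    moreover have "\<dots> \<le> P {}"
      using noise_energy_le_norm_2[of 1 n f] P_ge[of "{}"] by simp
    ultimately show ?thesis using True by simp
  next
    case False
    then have k: "1 \<le> k" by simp
    have "Cconst q ^ k * high_weight n k f = (\<Sum>J\<in>?\<J>. Cconst q ^ k * integral {0..1}
        (\<lambda>u. real k * u ^ (k - 1) * noise_energy n (1 - u) (disc_deriv_set J f)))"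
      unfolding high_weight_eq_integral[OF k] sum_distrib_left ..
    also have "\<dots> \<le> (\<Sum>J\<in>?\<J>. ?term J)"
    proof (rule sum_mono)
      fix J assume "J \<in> ?\<J>"
      then have J: "J \<subseteq> {1..n}" by simp
      let ?g = "disc_deriv_set J f"
      show "Cconst q ^ k * integral {0..1} (\<lambda>u. real k * u ^ (k - 1) * noise_energy n (1 - u) ?g) \<le> ?term J"
      proof (cases "\<exists>x\<in>cube n. ?g x \<noteq> 0")
        case True
        then have "0 < P J" "0 < cube_norm n q ?g"
          unfolding P_def using p q cube_norm_pos_iff[of p n ?g] cube_norm_pos_iff[of q n ?g] by auto
        then show ?thesis
          using noise_energy_integral_le[OF q k P_ge[OF J]] by simp
      next
        case g0: False
        have "fourier n ?g S = 0" for S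
          using g0 by (simp add: fourier_def cube_inner_def cube_integral)
        then show ?thesis using g0 by (simp add: noise_energy_def P_def cube_norm_def cube_integral)
      qed
    qed
    finally show ?thesis .
  qed
  then show "Cconst q ^ k * high_weight n k f \<le> (\<Sum>J\<in>?\<J>. cube_norm n p (disc_deriv_set J f) powr p /
      (1 + q / (2 * real k * (2 - q)) * ln_plus (cube_norm n p (disc_deriv_set J f) powr p /
        (cube_norm n q (disc_deriv_set J f))\<^sup>2)) ^ k)"
    by (simp add: P_def)
qed

end
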